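(* Let $\mathbf{k}=(k_1,\dots,k_m)$ be an index. Then $$\sum_{i=0}^{\infty}\zeta_{\widehat{\mathcal{A}}}^{\star}(\{1\}^i,\mathbf{k})\,\boldsymbol{p}^i=-\sum_{i=0}^{\infty}\zeta_{\widehat{\mathcal{A}}}^{\star}(\{1\}^i,\mathbf{k}^{\vee})\,\boldsymbol{p}^i$$ in the ring $\widehat{\mathcal{A}}$.
   Context: An index is a tuple $\mathbf{k}=(k_1,\dots,k_m)$ of positive integers ($m\ge 1$). $(\{1\}^i,\mathbf{k})$ denotes $(\underbrace{1,\dots,1}_{i},k_1,\dots,k_m)$. Hoffman dual: let $W$ be the free monoid on $\{0,1\}$. To an index $\mathbf{k}$ associate the word $w(\mathbf{k})=\underbrace{0\cdots0}_{k_1-1}1\underbrace{0\cdots0}_{k_2-1}1\cdots1\underbrace{0\cdots0}_{k_m-1}1$; $w$ is a bijection from the set of all indices onto $W1$ (words ending in $1$). Let $\tau\colon W\to W$ be the monoid homomorphism with $\tau(0)=1$, $\tau(1)=0$. The Hoffman dual $\mathbf{k}^{\vee}$ is the index determined by $w(\mathbf{k}^{\vee})=\tau(w(\mathbf{k})1^{-1})1$ (delete the last letter $1$, exchange $0$ and $1$, append $1$). Rings: for each positive integer $n$, $\mathcal{A}_n=\left(\prod_p\mathbb{Z}/p^n\mathbb{Z}\right)/\left(\bigoplus_p\mathbb{Z}/p^n\mathbb{Z}\right)$, where $p$ runs over all prime numbers, and $\widehat{\mathcal{A}}=\varprojlim_n\mathcal{A}_n$, where the $\mathcal{A}_n$ are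 discrete and $\widehat{\mathcal{A}}$ has the projective limit topology. There is a natural surjection $\pi\colon\prod_p\mathbb{Z}_p\to\widehat{\mathcal{A}}$ ($\mathbb{Z}_p$ the $p$-adic integers), induced by reduction mod $p^n$ in each component; since components at finitely many primes do not matter, $\pi$ may be applied to families defined for all but finitely many $p$. Put $\boldsymbol{p}=\pi((p)_p)$. The topology of $\widehat{\mathcal{A}}$ is the $\boldsymbol{p}$-adic topology, it is complete, and infinite sums are taken in this topology. Finite multiple zeta-star values: $\zeta_n^{\star}(\mathbf{k})=\sum_{n\ge n_1\ge\cdots\ge n_m\ge1}\frac{1}{n_1^{k_1}\cdots n_m^{k_m}}$ and $\zeta_{\widehat{\mathcal{A}}}^{\star}(\mathbf{k})=\pi\left((\zeta_{p-1}^{\star}(\mathbf{k}))_p\right)\in\widehat{\mathcal{A}}$. *)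

theory Defs
  imports
    "HOL-Number_Theory.Number_Theory"
    "HOL-Algebra.QuotRing"
    "HOL-Algebra.Subrings"
    "HOL-Analysis.Abstract_Topological_Spaces"
begin

section \<open>Indices and the Hoffman dual\<close>

definition is_index :: "nat list \<Rightarrow> bool" where
  "is_index k \<longleftrightarrow> k \<noteq> [] \<and> (\<forall>a\<in>set k. 1 \<le> a)"

text \<open>Words over the alphabet \<open>{0, 1}\<close> are boolean lists: \<open>False\<close> is the letter \<open>0\<close> and
  \<open>True\<close> is the letter \<open>1\<close>, so the letter-exchanging homomorphism \<open>\<tau>\<close> is \<open>map Not\<close>.\<close>

definition index_word :: "nat list \<Rightarrow> bool list" where
  "index_word k = concat (map (\<lambda>a. replicate (a - 1) False @ [True]) k)"

definition hoffman_dual :: "nat list \<Rightarrow> nat list" where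
  "hoffman_dual k =
     (THE l. is_index l \<and> index_word l = map Not (butlast (index_word k)) @ [True])"

lemma index_word_Cons: "index_word (a # k) = replicate (a - 1) False @ True # index_word k"
  by (simp add: index_word_def)

lemma index_word_exists:
  "\<exists>k. (\<forall>a\<in>set k. 1 \<le> a) \<and> index_word k = w @ [True]"
proof (induction w)
  case Nil
  show ?case by (rule exI[of _ "[1]"]) (simp add: index_word_def)
next
  case (Cons c w)
  then obtain k where k: "\<forall>a\<in>set k. 1 \<le> a" "index_word k = w @ [True]" by blast
  show ?case
  proof (cases c)
    case True
    with k show ?thesis by (intro exI[of _ "1 # k"]) (simp add: index_word_Cons)
  next
    case False
    from k obtain a l where "k = a # l" by (cases k) (auto simp: index_word_def)
    with k False show ?thesis
      by (intro exI[of _ "Suc a # l"]) (cases a, auto simp: index_word_Cons)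
  qed
qed

lemma index_word_inj:
  assumes "\<forall>a\<in>set k. 1 \<le> a" "\<forall>a\<in>set l. 1 \<le> a" "index_word k = index_word l"
  shows "k = l"
  using assms
proof (induction k arbitrary: l)
  case Nil
  then show ?case by (cases l) (auto simp: index_word_def)
next
  case (Cons a k)
  then obtain b l' where l: "l = b # l'" by (cases l) (auto simp: index_word_def)
  have eq: "replicate (a - 1) False @ True # index_word k = replicate (b - 1) False @ True # index_word l'"
    using Cons.prems(3) by (simp add: l index_word_Cons)
  have tw: "takeWhile Not (replicate n False @ True # w) = replicate n False" for n w
    by (induction n) auto
  have "a - 1 = b - 1"
    using arg_cong[OF eq, of "\<lambda>w. length (takeWhile Not w)"] by (simp add: tw)
  then show ?case
    using eq Cons.IH[of l'] Cons.prems by (auto simp: l)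
qed

lemma index_word_bij: "bij_betw index_word {k. is_index k} {w @ [True] | w. True}"
proof (rule bij_betw_imageI)
  show "inj_on index_word {k. is_index k}"
    by (rule inj_onI) (auto simp: is_index_def intro: index_word_inj)
  have "\<exists>w. index_word k = w @ [True]" if "k \<noteq> []" for k
    using that by (cases k rule: rev_cases) (auto simp: index_word_def)
  moreover have "w @ [True] \<in> index_word ` {k. is_index k}" for w
  proof -
    obtain k where k: "\<forall>a\<in>set k. 1 \<le> a" "index_word k = w @ [True]"
      using index_word_exists by blast
    then have "is_index k" by (auto simp: is_index_def index_word_def)
    with k show ?thesis by (metis image_eqI mem_Collect_eq)
  qed
  ultimately show "index_word ` {k. is_index k} = {w @ [True] | w. True}"
    by (auto simp: is_index_def)
qed

lemma hoffman_dual: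
  "is_index (hoffman_dual k) \<and>
     index_word (hoffman_dual k) = map Not (butlast (index_word k)) @ [True]"
  unfolding hoffman_dual_def
proof (rule theI')
  let ?w = "map Not (butlast (index_word k)) @ [True]"
  have "?w \<in> index_word ` {k. is_index k}"
    using bij_betw_imp_surj_on[OF index_word_bij] by blast
  moreover have "inj_on index_word {k. is_index k}"
    using index_word_bij by (rule bij_betw_imp_inj_on)
  ultimately show "\<exists>!l. is_index l \<and> index_word l = ?w"
    by (smt (verit, best) imageE inj_onD mem_Collect_eq)
qed


section \<open>Finite multiple zeta-star values\<close>

definition zeta_star :: "nat \<Rightarrow> nat list \<Rightarrow> rat" where
  "zeta_star n k =
     (\<Sum>ns | length ns = length k \<and> set ns \<subseteq> {1..n} \<and> sorted_wrt (\<ge>) ns.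
        \<Prod>i<length k. 1 / of_nat (ns ! i) ^ (k ! i))"


section \<open>Products and projective limits of rings\<close>

definition product_ring :: "'i set \<Rightarrow> ('i \<Rightarrow> ('a, 'b) ring_scheme) \<Rightarrow> ('i \<Rightarrow> 'a) ring" where
  "product_ring I R =
     \<lparr>carrier = (\<Pi>\<^sub>E i\<in>I. carrier (R i)),
      monoid.mult = (\<lambda>x y. \<lambda>i\<in>I. x i \<otimes>\<^bsub>R i\<^esub> y i),
      one = (\<lambda>i\<in>I. \<one>\<^bsub>R i\<^esub>),
      zero = (\<lambda>i\<in>I. \<zero>\<^bsub>R i\<^esub>),
      add = (\<lambda>x y. \<lambda>i\<in>I. x i \<oplus>\<^bsub>R i\<^esub> y i)\<rparr>"

definition direct_sum :: "'i set \<Rightarrow> ('i \<Rightarrow> ('a, 'b) ring_scheme) \<Rightarrow> ('i \<Rightarrow> 'a) set" where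
  "direct_sum I R = {x \<in> carrier (product_ring I R). finite {i\<in>I. x i \<noteq> \<zero>\<^bsub>R i\<^esub>}}"

text \<open>The projective limit of \<open>R 1 \<leftarrow> R 2 \<leftarrow> R 3 \<leftarrow> \<dots>\<close>, where \<open>t n\<close> maps \<open>R (n + 1)\<close> to \<open>R n\<close>.
  The indices start at \<open>1\<close>.\<close>

definition proj_limit ::
    "(nat \<Rightarrow> ('a, 'b) ring_scheme) \<Rightarrow> (nat \<Rightarrow> 'a \<Rightarrow> 'a) \<Rightarrow> (nat \<Rightarrow> 'a) ring" where
  "proj_limit R t = (product_ring {1..} R)
     \<lparr>carrier := {x \<in> carrier (product_ring {1..} R). \<forall>n\<ge>1. t n (x (Suc n)) = x n}\<rparr>"


section \<open>The rings \<open>\<A>\<^sub>n\<close> and \<open>\<A>\<close>-hat\<close>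

abbreviation primes :: "nat set" where
  "primes \<equiv> {p. prime p}"

definition prod_Zmod :: "nat \<Rightarrow> (nat \<Rightarrow> int) ring" where
  "prod_Zmod n = product_ring primes (\<lambda>p. residue_ring (int p ^ n))"

definition sum_Zmod :: "nat \<Rightarrow> (nat \<Rightarrow> int) set" where
  "sum_Zmod n = direct_sum primes (\<lambda>p. residue_ring (int p ^ n))"

definition A_ring :: "nat \<Rightarrow> (nat \<Rightarrow> int) set ring" where
  "A_ring n = prod_Zmod n Quot sum_Zmod n"

definition reduce :: "nat \<Rightarrow> (nat \<Rightarrow> int) \<Rightarrow> nat \<Rightarrow> int" where
  "reduce n x = (\<lambda>p\<in>primes. x p mod int p ^ n)"

text \<open>An element of \<open>A_ring (n + 1)\<close> is a coset of \<open>sum_Zmod (n + 1)\<close>; the elementwise image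
  of the coset of \<open>x\<close> is the coset of \<open>reduce n x\<close> in \<open>A_ring n\<close>.\<close>

definition A_trans :: "nat \<Rightarrow> (nat \<Rightarrow> int) set \<Rightarrow> (nat \<Rightarrow> int) set" where
  "A_trans n C = reduce n ` C"

definition A_hat :: "(nat \<Rightarrow> (nat \<Rightarrow> int) set) ring" where
  "A_hat = proj_limit A_ring A_trans"

definition A_hat_topology :: "(nat \<Rightarrow> (nat \<Rightarrow> int) set) topology" where
  "A_hat_topology = subtopology
     (product_topology (\<lambda>n. discrete_topology (carrier (A_ring n))) {1..}) (carrier A_hat)"

definition A_hat_sums ::
    "(nat \<Rightarrow> (nat \<Rightarrow> (nat \<Rightarrow> int) set)) \<Rightarrow> (nat \<Rightarrow> (nat \<Rightarrow> int) set) \<Rightarrow> bool" where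
  "A_hat_sums f s \<longleftrightarrow>
     limitin A_hat_topology (\<lambda>N. finsum A_hat f {..<N}) s sequentially"

definition A_hat_summable :: "(nat \<Rightarrow> (nat \<Rightarrow> (nat \<Rightarrow> int) set)) \<Rightarrow> bool" where
  "A_hat_summable f \<longleftrightarrow> (\<exists>s. A_hat_sums f s)"

definition A_hat_suminf ::
    "(nat \<Rightarrow> (nat \<Rightarrow> (nat \<Rightarrow> int) set)) \<Rightarrow> (nat \<Rightarrow> (nat \<Rightarrow> int) set)" where
  "A_hat_suminf f = (THE s. A_hat_sums f s)"


section \<open>The \<open>p\<close>-adic integers and the projection onto \<open>\<A>\<close>-hat\<close>

definition Zp :: "nat \<Rightarrow> (nat \<Rightarrow> int) ring" where
  "Zp p = proj_limit (\<lambda>n. residue_ring (int p ^ n)) (\<lambda>n a. a mod int p ^ n)"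

text \<open>The embedding into \<open>Zp p\<close> of the rationals whose denominator is prime to \<open>p\<close>;
  other rationals get junk values.\<close>

definition rat_to_Zp :: "nat \<Rightarrow> rat \<Rightarrow> nat \<Rightarrow> int" where
  "rat_to_Zp p r = (\<lambda>n\<in>{1..}. case quotient_of r of (a, b) \<Rightarrow>
     a * modular_inverse (int p ^ n) b mod int p ^ n)"

definition A_hat_proj :: "(nat \<Rightarrow> nat \<Rightarrow> int) \<Rightarrow> (nat \<Rightarrow> (nat \<Rightarrow> int) set)" where
  "A_hat_proj x = (\<lambda>n\<in>{1..}. sum_Zmod n +>\<^bsub>prod_Zmod n\<^esub> (\<lambda>p\<in>primes. x p n))"

definition p_hat :: "nat \<Rightarrow> (nat \<Rightarrow> int) set" where
  "p_hat = A_hat_proj (\<lambda>p\<in>primes. rat_to_Zp p (of_nat p))"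

definition zeta_star_hat :: "nat list \<Rightarrow> nat \<Rightarrow> (nat \<Rightarrow> int) set" where
  "zeta_star_hat k = A_hat_proj (\<lambda>p\<in>primes. rat_to_Zp p (zeta_star (p - 1) k))"


section \<open>Basic facts\<close>

lemma product_ring_cring:
  assumes "\<And>i. i \<in> I \<Longrightarrow> cring (R i)"
  shows "cring (product_ring I R)"
proof -
  have R: "ring (R i)" "abelian_group (R i)" "comm_monoid (R i)" "monoid (R i)" "abelian_monoid (R i)" if "i \<in> I" for i
    using assms[OF that] by (auto simp: cring_def ring_def comm_monoid_def abelian_group_def)
  have mem: "x i \<in> carrier (R i)" if "x \<in> carrier (product_ring I R)" "i \<in> I" for x i
    using that by (auto simp: product_ring_def)
  have arb: "x i = undefined" if "x \<in> carrier (product_ring I R)" "i \<notin> I" for x i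
    using that PiE_arb[of x I _ i] by (simp add: product_ring_def)
  have carr: "(\<lambda>i\<in>I. f i) \<in> carrier (product_ring I R) \<longleftrightarrow> (\<forall>i\<in>I. f i \<in> carrier (R i))" for f
    by (auto simp: product_ring_def)
  have ops: "x \<otimes>\<^bsub>product_ring I R\<^esub> y = (\<lambda>i\<in>I. x i \<otimes>\<^bsub>R i\<^esub> y i)"
    "x \<oplus>\<^bsub>product_ring I R\<^esub> y = (\<lambda>i\<in>I. x i \<oplus>\<^bsub>R i\<^esub> y i)"
    "\<one>\<^bsub>product_ring I R\<^esub> = (\<lambda>i\<in>I. \<one>\<^bsub>R i\<^esub>)"
    "\<zero>\<^bsub>product_ring I R\<^esub> = (\<lambda>i\<in>I. \<zero>\<^bsub>R i\<^esub>)" for x y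
    by (simp_all add: product_ring_def)
  note simps = ops carr mem fun_eq_iff
  show ?thesis
  proof (rule cringI)
    show "abelian_group (product_ring I R)"
    proof (rule abelian_groupI)
      fix x assume x: "x \<in> carrier (product_ring I R)"
      then show "\<exists>y\<in>carrier (product_ring I R). y \<oplus>\<^bsub>product_ring I R\<^esub> x = \<zero>\<^bsub>product_ring I R\<^esub>"
        by (intro bexI[of _ "\<lambda>i\<in>I. \<ominus>\<^bsub>R i\<^esub> x i"])
           (simp_all add: simps abelian_group.l_neg[OF R(2)] abelian_group.a_inv_closed[OF R(2)])
      show "\<zero>\<^bsub>product_ring I R\<^esub> \<oplus>\<^bsub>product_ring I R\<^esub> x = x"
        using x by (auto simp: simps abelian_monoid.l_zero[OF R(5)] arb[OF x])
    next
      fix x y assume "x \<in> carrier (product_ring I R)" "y \<in> carrier (product_ring I R)"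
      then show "x \<oplus>\<^bsub>product_ring I R\<^esub> y \<in> carrier (product_ring I R)"
        "x \<oplus>\<^bsub>product_ring I R\<^esub> y = y \<oplus>\<^bsub>product_ring I R\<^esub> x"
        by (simp_all add: simps abelian_monoid.a_closed[OF R(5)] abelian_monoid.a_comm[OF R(5)])
    qed (simp_all add: simps abelian_monoid.zero_closed[OF R(5)] abelian_monoid.a_assoc[OF R(5)])
    show "comm_monoid (product_ring I R)"
    proof (rule comm_monoidI)
      fix x assume x: "x \<in> carrier (product_ring I R)"
      then show "\<one>\<^bsub>product_ring I R\<^esub> \<otimes>\<^bsub>product_ring I R\<^esub> x = x"
        by (auto simp: simps monoid.l_one[OF R(4)] arb[OF x])
    next
      fix x y assume "x \<in> carrier (product_ring I R)" "y \<in> carrier (product_ring I R)"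
      then show "x \<otimes>\<^bsub>product_ring I R\<^esub> y \<in> carrier (product_ring I R)"
        "x \<otimes>\<^bsub>product_ring I R\<^esub> y = y \<otimes>\<^bsub>product_ring I R\<^esub> x"
        by (simp_all add: simps monoid.m_closed[OF R(4)] comm_monoid.m_comm[OF R(3)])
    qed (simp_all add: simps monoid.one_closed[OF R(4)] monoid.m_assoc[OF R(4)])
  next
    fix x y z assume "x \<in> carrier (product_ring I R)" "y \<in> carrier (product_ring I R)" "z \<in> carrier (product_ring I R)"
    then show "(x \<oplus>\<^bsub>product_ring I R\<^esub> y) \<otimes>\<^bsub>product_ring I R\<^esub> z =
      x \<otimes>\<^bsub>product_ring I R\<^esub> z \<oplus>\<^bsub>product_ring I R\<^esub> y \<otimes>\<^bsub>product_ring I R\<^esub> z"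
      by (simp add: simps ring.ring_simprules(13)[OF R(1)])
  qed
qed

lemma product_ring_simps:
  "carrier (product_ring I R) = (\<Pi>\<^sub>E i\<in>I. carrier (R i))"
  "x \<otimes>\<^bsub>product_ring I R\<^esub> y = (\<lambda>i\<in>I. x i \<otimes>\<^bsub>R i\<^esub> y i)"
  "x \<oplus>\<^bsub>product_ring I R\<^esub> y = (\<lambda>i\<in>I. x i \<oplus>\<^bsub>R i\<^esub> y i)"
  "\<one>\<^bsub>product_ring I R\<^esub> = (\<lambda>i\<in>I. \<one>\<^bsub>R i\<^esub>)"
  "\<zero>\<^bsub>product_ring I R\<^esub> = (\<lambda>i\<in>I. \<zero>\<^bsub>R i\<^esub>)"
  by (simp_all add: product_ring_def)

lemma product_ring_minus:
  assumes R: "\<And>i. i \<in> I \<Longrightarrow> cring (R i)" and x: "x \<in> carrier (product_ring I R)"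
  shows "\<ominus>\<^bsub>product_ring I R\<^esub> x = (\<lambda>i\<in>I. \<ominus>\<^bsub>R i\<^esub> x i)"
proof -
  interpret P: cring "product_ring I R" by (rule product_ring_cring) fact
  have A: "abelian_group (R i)" if "i \<in> I" for i
    using R[OF that] by (auto simp: cring_def ring_def)
  have xm: "x i \<in> carrier (R i)" if "i \<in> I" for i
    using x that by (auto simp: product_ring_simps)
  show ?thesis
    by (rule P.minus_equality)
       (use x xm in \<open>auto simp: product_ring_simps fun_eq_iff abelian_group.l_neg[OF A]
          abelian_group.a_inv_closed[OF A]\<close>)
qed

lemma direct_sum_ideal:
  assumes R: "\<And>i. i \<in> I \<Longrightarrow> cring (R i)"
  shows "ideal (direct_sum I R) (product_ring I R)"
proof -
  interpret P: cring "product_ring I R" by (rule product_ring_cring) fact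
  have A: "ring (R i)" if "i \<in> I" for i
    using R[OF that] by (auto simp: cring_def)
  have Z: "\<ominus>\<^bsub>R i\<^esub> \<zero>\<^bsub>R i\<^esub> = \<zero>\<^bsub>R i\<^esub>" if "i \<in> I" for i
  proof -
    interpret ring "R i" by (rule A[OF that])
    show ?thesis by simp
  qed
  show ?thesis
  proof (rule idealI)
    show "subgroup (direct_sum I R) (add_monoid (product_ring I R))"
    proof (rule P.add.subgroupI)
      show "direct_sum I R \<noteq> {}"
  proof -
        have "\<zero>\<^bsub>product_ring I R\<^esub> \<in> direct_sum I R"
          using P.zero_closed by (auto simp: direct_sum_def product_ring_simps(5))
        then show ?thesis by blast
      qed
    next
      fix a assume a: "a \<in> direct_sum I R"
      then have "finite {i\<in>I. a i \<noteq> \<zero>\<^bsub>R i\<^esub>}" "a \<in> carrier (product_ring I R)"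
        by (auto simp: direct_sum_def)
      moreover have "{i\<in>I. (\<ominus>\<^bsub>product_ring I R\<^esub> a) i \<noteq> \<zero>\<^bsub>R i\<^esub>} \<subseteq> {i\<in>I. a i \<noteq> \<zero>\<^bsub>R i\<^esub>}"
        using calculation(2) Z by (auto simp: product_ring_minus R)
      ultimately show "\<ominus>\<^bsub>product_ring I R\<^esub> a \<in> direct_sum I R"
        by (auto simp: direct_sum_def intro: finite_subset)
    next
      fix a b assume a: "a \<in> direct_sum I R" and b: "b \<in> direct_sum I R"
      have "{i\<in>I. (a \<oplus>\<^bsub>product_ring I R\<^esub> b) i \<noteq> \<zero>\<^bsub>R i\<^esub>} \<subseteq>
          {i\<in>I. a i \<noteq> \<zero>\<^bsub>R i\<^esub>} \<union> {i\<in>I. b i \<noteq> \<zero>\<^bsub>R i\<^esub>}"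
        using A by (auto simp: product_ring_simps ring.ring_simprules)
      moreover have "finite \<dots>" using a b by (auto simp: direct_sum_def)
      ultimately show "a \<oplus>\<^bsub>product_ring I R\<^esub> b \<in> direct_sum I R"
        using a b P.a_closed by (auto simp: direct_sum_def intro: finite_subset)
    qed (auto simp: direct_sum_def)
  next
    fix a x assume a: "a \<in> direct_sum I R" and x: "x \<in> carrier (product_ring I R)"
    have "{i\<in>I. (x \<otimes>\<^bsub>product_ring I R\<^esub> a) i \<noteq> \<zero>\<^bsub>R i\<^esub>} \<subseteq> {i\<in>I. a i \<noteq> \<zero>\<^bsub>R i\<^esub>}"
    proof -
      have "x i \<in> carrier (R i)" if "i \<in> I" for i
        using x that by (auto simp: product_ring_simps)
      then show ?thesis
        using A by (auto simp: product_ring_simps ring.ring_simprules)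
    qed
    moreover have "finite \<dots>" using a by (auto simp: direct_sum_def)
    ultimately show *: "x \<otimes>\<^bsub>product_ring I R\<^esub> a \<in> direct_sum I R"
      using a x P.m_closed by (auto simp: direct_sum_def intro: finite_subset)
    then show "a \<otimes>\<^bsub>product_ring I R\<^esub> x \<in> direct_sum I R"
      using a x P.m_comm by (auto simp: direct_sum_def)
  qed (rule P.ring_axioms)
qed

lemma proj_limit_cring:
  assumes R: "\<And>n. 1 \<le> n \<Longrightarrow> cring (R n)"
    and t: "\<And>n. 1 \<le> n \<Longrightarrow> t n \<in> ring_hom (R (Suc n)) (R n)"
  shows "cring (proj_limit R t)"
proof -
  have cr: "cring (R n)" if "n \<in> {1..}" for n using R that by simp
  interpret P: cring "product_ring {1..} R" by (rule product_ring_cring) (rule cr)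
  define H where "H = {x \<in> carrier (product_ring {1..} R). \<forall>n\<ge>1. t n (x (Suc n)) = x n}"
  have hom: "ring_hom_ring (R (Suc n)) (R n) (t n)" if "1 \<le> n" for n
    using R[OF that] R[of "Suc n"] t[OF that] by (intro ring_hom_ringI2) (auto simp: cring_def)
  have mem: "x n \<in> carrier (R n)" "x (Suc n) \<in> carrier (R (Suc n))"
    if "x \<in> carrier (product_ring {1..} R)" "1 \<le> n" for x n
    using that by (auto simp: product_ring_simps)
  have H: "h \<in> carrier (product_ring {1..} R)" "1 \<le> n \<Longrightarrow> t n (h (Suc n)) = h n" if "h \<in> H" for h n
    using that by (auto simp: H_def)
  have HI: "h \<in> H" if "h \<in> carrier (product_ring {1..} R)" "\<And>n. 1 \<le> n \<Longrightarrow> t n (h (Suc n)) = h n" for h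
    using that by (auto simp: H_def)
  have "subring H (product_ring {1..} R)"
  proof (rule P.subringI)
    show "H \<subseteq> carrier (product_ring {1..} R)" using H(1) by blast
    show "\<one>\<^bsub>product_ring {1..} R\<^esub> \<in> H"
      by (rule HI, rule P.one_closed) (simp add: product_ring_simps(4) ring_hom_one[OF t])
  next
    fix h assume h: "h \<in> H"
    show "\<ominus>\<^bsub>product_ring {1..} R\<^esub> h \<in> H"
    proof (rule HI)
      show "\<ominus>\<^bsub>product_ring {1..} R\<^esub> h \<in> carrier (product_ring {1..} R)"
        using H(1)[OF h] by (rule P.a_inv_closed)
      have m: "\<ominus>\<^bsub>product_ring {1..} R\<^esub> h = (\<lambda>n\<in>{1..}. \<ominus>\<^bsub>R n\<^esub> h n)"
        by (rule product_ring_minus[OF _ H(1)[OF h]]) (rule cr)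
      fix n :: nat assume n: "1 \<le> n"
      interpret H: ring_hom_ring "R (Suc n)" "R n" "t n" by (rule hom[OF n])
      show "t n ((\<ominus>\<^bsub>product_ring {1..} R\<^esub> h) (Suc n)) = (\<ominus>\<^bsub>product_ring {1..} R\<^esub> h) n"
        using n H(2)[OF h n] mem[OF H(1)[OF h] n] unfolding m by simp
    qed
  next
    fix h1 h2 assume h: "h1 \<in> H" "h2 \<in> H"
    note c = H(1)[OF h(1)] H(1)[OF h(2)]
    show "h1 \<otimes>\<^bsub>product_ring {1..} R\<^esub> h2 \<in> H"
    proof (rule HI)
      fix n :: nat assume n: "1 \<le> n"
      show "t n ((h1 \<otimes>\<^bsub>product_ring {1..} R\<^esub> h2) (Suc n)) = (h1 \<otimes>\<^bsub>product_ring {1..} R\<^esub> h2) n"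
        using n by (simp add: product_ring_simps(2) ring_hom_mult[OF t[OF n]]
          H(2)[OF h(1) n] H(2)[OF h(2) n] mem[OF c(1) n] mem[OF c(2) n])
    qed (rule P.m_closed[OF c])
    show "h1 \<oplus>\<^bsub>product_ring {1..} R\<^esub> h2 \<in> H"
    proof (rule HI)
      fix n :: nat assume n: "1 \<le> n"
      show "t n ((h1 \<oplus>\<^bsub>product_ring {1..} R\<^esub> h2) (Suc n)) = (h1 \<oplus>\<^bsub>product_ring {1..} R\<^esub> h2) n"
        using n by (simp add: product_ring_simps(3) ring_hom_add[OF t[OF n]]
          H(2)[OF h(1) n] H(2)[OF h(2) n] mem[OF c(1) n] mem[OF c(2) n])
    qed (rule P.a_closed[OF c])
  qed
  then have "subcring H (product_ring {1..} R)" by (rule P.subcringI')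
  have H_sub: "H \<subseteq> carrier (product_ring {1..} R)" using H(1) by blast
  show ?thesis
    using \<open>subcring H _\<close> P.subcring_iff[OF H_sub] by (simp add: proj_limit_def H_def)
qed

lemma residue_ring_power_cring:
  assumes "prime p" "1 \<le> n"
  shows "cring (residue_ring (int p ^ n))"
proof -
  have "int p ^ n > 1" using assms prime_gt_1_nat[of p] by (intro one_less_power) auto
  then interpret residues "int p ^ n" "residue_ring (int p ^ n)" by unfold_locales auto
  show ?thesis by (rule cring)
qed

lemma reduce_residue_ring_hom:
  assumes "prime p" "1 \<le> n"
  shows "(\<lambda>a. a mod int p ^ n) \<in> ring_hom (residue_ring (int p ^ Suc n)) (residue_ring (int p ^ n))"
proof -
  have "int p ^ n > 1" using assms prime_gt_1_nat[of p] by (intro one_less_power) auto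
  moreover have "a mod (int p * int p ^ n) mod int p ^ n = a mod int p ^ n"
    "0 \<le> a mod int p ^ n" "a mod int p ^ n < int p ^ n" for a
    using prime_gt_0_nat[OF assms(1)] pos_mod_sign[of "int p ^ n" a] pos_mod_bound[of "int p ^ n" a]
    by (simp_all del: pos_mod_sign pos_mod_bound add: mod_mod_cancel)
  ultimately show ?thesis
    by (auto simp: ring_hom_def residue_ring_def mod_simps)
qed

lemma Zp_cring:
  assumes "prime p"
  shows "cring (Zp p)"
  unfolding Zp_def
  using assms residue_ring_power_cring reduce_residue_ring_hom by (intro proj_limit_cring) auto

lemma prod_Zmod_cring: "1 \<le> n \<Longrightarrow> cring (prod_Zmod n)"
  unfolding prod_Zmod_def by (rule product_ring_cring) (auto intro: residue_ring_power_cring)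

lemma sum_Zmod_ideal: "1 \<le> n \<Longrightarrow> ideal (sum_Zmod n) (prod_Zmod n)"
  unfolding prod_Zmod_def sum_Zmod_def by (rule direct_sum_ideal) (auto intro: residue_ring_power_cring)

lemma A_ring_cring: "1 \<le> n \<Longrightarrow> cring (A_ring n)"
  unfolding A_ring_def by (intro ideal.quotient_is_cring sum_Zmod_ideal prod_Zmod_cring)

lemma prod_Zmod_simps:
  "carrier (prod_Zmod n) = (\<Pi>\<^sub>E p\<in>primes. carrier (residue_ring (int p ^ n)))"
  "x \<otimes>\<^bsub>prod_Zmod n\<^esub> y = (\<lambda>p\<in>primes. x p \<otimes>\<^bsub>residue_ring (int p ^ n)\<^esub> y p)"
  "x \<oplus>\<^bsub>prod_Zmod n\<^esub> y = (\<lambda>p\<in>primes. x p \<oplus>\<^bsub>residue_ring (int p ^ n)\<^esub> y p)"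
  "\<one>\<^bsub>prod_Zmod n\<^esub> = (\<lambda>p\<in>primes. \<one>\<^bsub>residue_ring (int p ^ n)\<^esub>)"
  "\<zero>\<^bsub>prod_Zmod n\<^esub> = (\<lambda>p\<in>primes. \<zero>\<^bsub>residue_ring (int p ^ n)\<^esub>)"
  by (simp_all add: prod_Zmod_def product_ring_simps)

lemma sum_Zmod_iff:
  "x \<in> sum_Zmod n \<longleftrightarrow>
     x \<in> carrier (prod_Zmod n) \<and> finite {p\<in>primes. x p \<noteq> \<zero>\<^bsub>residue_ring (int p ^ n)\<^esub>}"
  by (simp add: sum_Zmod_def prod_Zmod_def direct_sum_def)

lemma prod_Zmod_carrier_iff:
  assumes "x \<in> extensional primes"
  shows "x \<in> carrier (prod_Zmod n) \<longleftrightarrow> (\<forall>p. prime p \<longrightarrow> 0 \<le> x p \<and> x p < int p ^ n)"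
  using assms by (auto simp: prod_Zmod_simps residue_ring_def PiE_iff)

lemma reduce_hom:
  assumes n: "1 \<le> n"
  shows "reduce n \<in> ring_hom (prod_Zmod (Suc n)) (prod_Zmod n)"
proof -
  note hom = reduce_residue_ring_hom[OF _ n]
  have mem: "x p \<in> carrier (residue_ring (int p ^ Suc n))" if "x \<in> carrier (prod_Zmod (Suc n))" "prime p" for x p
    using that by (auto simp: prod_Zmod_simps(1))
  show ?thesis
  proof (rule ring_hom_memI)
    fix x assume "x \<in> carrier (prod_Zmod (Suc n))"
    then show "reduce n x \<in> carrier (prod_Zmod n)"
      using ring_hom_closed[OF hom mem] by (simp add: prod_Zmod_simps(1) reduce_def)
  next
    fix x y assume c: "x \<in> carrier (prod_Zmod (Suc n))" "y \<in> carrier (prod_Zmod (Suc n))"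
    show "reduce n (x \<otimes>\<^bsub>prod_Zmod (Suc n)\<^esub> y) = reduce n x \<otimes>\<^bsub>prod_Zmod n\<^esub> reduce n y"
      using ring_hom_mult[OF hom mem mem] c
      unfolding prod_Zmod_simps(2) reduce_def by (intro restrict_ext) simp
    show "reduce n (x \<oplus>\<^bsub>prod_Zmod (Suc n)\<^esub> y) = reduce n x \<oplus>\<^bsub>prod_Zmod n\<^esub> reduce n y"
      using ring_hom_add[OF hom mem mem] c
      unfolding prod_Zmod_simps(3) reduce_def by (intro restrict_ext) simp
  next
    show "reduce n \<one>\<^bsub>prod_Zmod (Suc n)\<^esub> = \<one>\<^bsub>prod_Zmod n\<^esub>"
      using ring_hom_one[OF hom]
      unfolding prod_Zmod_simps(4) reduce_def by (intro restrict_ext) simp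
  qed
qed

lemma reduce_sum_Zmod:
  assumes n: "1 \<le> n"
  shows "reduce n ` sum_Zmod (Suc n) = sum_Zmod n"
proof (intro equalityI subsetI)
  fix y assume "y \<in> reduce n ` sum_Zmod (Suc n)"
  then obtain x where x: "x \<in> sum_Zmod (Suc n)" "y = reduce n x" by blast
  have "y \<in> carrier (prod_Zmod n)"
    using x ring_hom_closed[OF reduce_hom[OF n]] by (auto simp: sum_Zmod_iff)
  moreover have "{p\<in>primes. y p \<noteq> \<zero>\<^bsub>residue_ring (int p ^ n)\<^esub>} \<subseteq>
      {p\<in>primes. x p \<noteq> \<zero>\<^bsub>residue_ring (int p ^ Suc n)\<^esub>}"
    by (auto simp: x(2) reduce_def residue_ring_def)
  ultimately show "y \<in> sum_Zmod n"
    using x(1) by (auto simp: sum_Zmod_iff intro: finite_subset)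
next
  fix x assume x: "x \<in> sum_Zmod n"
  then have e: "x \<in> extensional primes" and c: "x \<in> carrier (prod_Zmod n)"
    by (auto simp: sum_Zmod_iff prod_Zmod_simps(1) PiE_def)
  have b: "0 \<le> x p" "x p < int p ^ n" if "prime p" for p
    using c that prod_Zmod_carrier_iff[OF e] by auto
  have "x p < int p ^ Suc n" if "prime p" for p
  proof -
    have "int p ^ n \<le> int p ^ Suc n"
      using prime_gt_0_nat[OF that] by (intro power_increasing) auto
    then show ?thesis using b[OF that] by linarith
  qed
  then have "x \<in> carrier (prod_Zmod (Suc n))"
    using b by (simp only: prod_Zmod_carrier_iff[OF e]) simp
  then have "x \<in> sum_Zmod (Suc n)"
    using x by (simp add: sum_Zmod_iff residue_ring_def)
  moreover have "reduce n x = x"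
    using b e by (auto simp: reduce_def fun_eq_iff extensional_def)
  ultimately show "x \<in> reduce n ` sum_Zmod (Suc n)" by force
qed

lemma A_trans_coset:
  assumes n: "1 \<le> n" and x: "x \<in> carrier (prod_Zmod (Suc n))"
  shows "A_trans n (sum_Zmod (Suc n) +>\<^bsub>prod_Zmod (Suc n)\<^esub> x) =
    sum_Zmod n +>\<^bsub>prod_Zmod n\<^esub> reduce n x"
proof -
  have "reduce n (h \<oplus>\<^bsub>prod_Zmod (Suc n)\<^esub> x) = reduce n h \<oplus>\<^bsub>prod_Zmod n\<^esub> reduce n x"
    if "h \<in> sum_Zmod (Suc n)" for h
    using that x by (intro ring_hom_add[OF reduce_hom[OF n]]) (auto simp: sum_Zmod_iff)
  note * = this
  have "A_trans n (sum_Zmod (Suc n) +>\<^bsub>prod_Zmod (Suc n)\<^esub> x) =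
      (\<Union>h\<in>sum_Zmod (Suc n). {reduce n (h \<oplus>\<^bsub>prod_Zmod (Suc n)\<^esub> x)})"
    unfolding A_trans_def a_r_coset_def' by (simp only: image_UN image_insert image_empty)
  also have "\<dots> = (\<Union>h\<in>sum_Zmod (Suc n). {reduce n h \<oplus>\<^bsub>prod_Zmod n\<^esub> reduce n x})"
    by (rule SUP_cong) (simp_all only: *)
  also have "\<dots> = (\<Union>h\<in>reduce n ` sum_Zmod (Suc n). {h \<oplus>\<^bsub>prod_Zmod n\<^esub> reduce n x})"
    by blast
  finally show ?thesis
    unfolding reduce_sum_Zmod[OF n] by (simp only: a_r_coset_def')
qed

lemma A_ring_simps:
  "carrier (A_ring n) = (\<lambda>x. sum_Zmod n +>\<^bsub>prod_Zmod n\<^esub> x) ` carrier (prod_Zmod n)"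
  "\<one>\<^bsub>A_ring n\<^esub> = sum_Zmod n +>\<^bsub>prod_Zmod n\<^esub> \<one>\<^bsub>prod_Zmod n\<^esub>"
  by (auto simp: A_ring_def FactRing_def A_RCOSETS_def')

lemma A_ring_mult:
  assumes "1 \<le> n" "x \<in> carrier (prod_Zmod n)" "y \<in> carrier (prod_Zmod n)"
  shows "(sum_Zmod n +>\<^bsub>prod_Zmod n\<^esub> x) \<otimes>\<^bsub>A_ring n\<^esub> (sum_Zmod n +>\<^bsub>prod_Zmod n\<^esub> y) =
    sum_Zmod n +>\<^bsub>prod_Zmod n\<^esub> (x \<otimes>\<^bsub>prod_Zmod n\<^esub> y)"
  using ideal.rcoset_mult_add[OF sum_Zmod_ideal] assms by (simp add: A_ring_def FactRing_def)

lemma A_ring_add: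
  assumes "1 \<le> n" "x \<in> carrier (prod_Zmod n)" "y \<in> carrier (prod_Zmod n)"
  shows "(sum_Zmod n +>\<^bsub>prod_Zmod n\<^esub> x) \<oplus>\<^bsub>A_ring n\<^esub> (sum_Zmod n +>\<^bsub>prod_Zmod n\<^esub> y) =
    sum_Zmod n +>\<^bsub>prod_Zmod n\<^esub> (x \<oplus>\<^bsub>prod_Zmod n\<^esub> y)"
  using ideal.a_rcos_sum[OF sum_Zmod_ideal] assms by (simp add: A_ring_def FactRing_def)

lemma A_trans_hom:
  assumes n: "1 \<le> n"
  shows "A_trans n \<in> ring_hom (A_ring (Suc n)) (A_ring n)"
proof -
  have n': "1 \<le> Suc n" by simp
  interpret P: cring "prod_Zmod (Suc n)" by (rule prod_Zmod_cring) simp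
  note hom = reduce_hom[OF n]
  note simps = A_trans_coset[OF n] A_ring_mult A_ring_add ring_hom_closed[OF hom]
    ring_hom_add[OF hom] ring_hom_mult[OF hom]
  show ?thesis
  proof (rule ring_hom_memI)
    show "A_trans n \<one>\<^bsub>A_ring (Suc n)\<^esub> = \<one>\<^bsub>A_ring n\<^esub>"
      by (simp add: A_ring_simps(2) A_trans_coset[OF n] ring_hom_one[OF hom])
  next
    fix C assume "C \<in> carrier (A_ring (Suc n))"
    then show "A_trans n C \<in> carrier (A_ring n)"
      unfolding A_ring_simps(1) by (elim imageE) (simp add: simps)
  next
    fix C D assume "C \<in> carrier (A_ring (Suc n))" "D \<in> carrier (A_ring (Suc n))"
    then obtain x y where C: "C = sum_Zmod (Suc n) +>\<^bsub>prod_Zmod (Suc n)\<^esub> x"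
        and D: "D = sum_Zmod (Suc n) +>\<^bsub>prod_Zmod (Suc n)\<^esub> y"
        and x: "x \<in> carrier (prod_Zmod (Suc n))" and y: "y \<in> carrier (prod_Zmod (Suc n))"
      unfolding A_ring_simps(1) by blast
    show "A_trans n (C \<otimes>\<^bsub>A_ring (Suc n)\<^esub> D) = A_trans n C \<otimes>\<^bsub>A_ring n\<^esub> A_trans n D"
      "A_trans n (C \<oplus>\<^bsub>A_ring (Suc n)\<^esub> D) = A_trans n C \<oplus>\<^bsub>A_ring n\<^esub> A_trans n D"
      unfolding C D A_ring_mult[OF n' x y] A_ring_add[OF n' x y] using n x y by (simp_all add: simps)
  qed
qed

lemma A_hat_cring: "cring A_hat"
  unfolding A_hat_def using A_ring_cring A_trans_hom by (rule proj_limit_cring)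

lemma proj_limit_simps:
  "x \<otimes>\<^bsub>proj_limit R t\<^esub> y = (\<lambda>n\<in>{1..}. x n \<otimes>\<^bsub>R n\<^esub> y n)"
  "x \<oplus>\<^bsub>proj_limit R t\<^esub> y = (\<lambda>n\<in>{1..}. x n \<oplus>\<^bsub>R n\<^esub> y n)"
  "\<one>\<^bsub>proj_limit R t\<^esub> = (\<lambda>n\<in>{1..}. \<one>\<^bsub>R n\<^esub>)"
  by (simp_all add: proj_limit_def product_ring_def)

lemma proj_limit_carrier:
  "x \<in> carrier (proj_limit R t) \<longleftrightarrow> x \<in> extensional {1..} \<and>
     (\<forall>n\<ge>1. x n \<in> carrier (R n) \<and> t n (x (Suc n)) = x n)"
  by (auto simp: proj_limit_def product_ring_def PiE_iff)

lemma Zp_product_component: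
  assumes "x \<in> carrier (product_ring primes Zp)" "1 \<le> n"
  shows "(\<lambda>p\<in>primes. x p n) \<in> carrier (prod_Zmod n)"
    and "reduce n (\<lambda>p\<in>primes. x p (Suc n)) = (\<lambda>p\<in>primes. x p n)"
proof -
  have x: "x p \<in> carrier (Zp p)" if "prime p" for p
    using assms(1) that by (auto simp: product_ring_simps(1))
  show "(\<lambda>p\<in>primes. x p n) \<in> carrier (prod_Zmod n)"
    using x assms(2) by (simp add: prod_Zmod_simps(1) Zp_def proj_limit_carrier)
  show "reduce n (\<lambda>p\<in>primes. x p (Suc n)) = (\<lambda>p\<in>primes. x p n)"
    unfolding reduce_def using x assms(2) by (intro restrict_ext) (simp add: Zp_def proj_limit_carrier)
qed

lemma A_hat_proj_hom: "A_hat_proj \<in> ring_hom (product_ring primes Zp) A_hat"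
proof (rule ring_hom_memI)
  fix x assume x: "x \<in> carrier (product_ring primes Zp)"
  show "A_hat_proj x \<in> carrier A_hat"
    unfolding A_hat_def proj_limit_carrier
    using Zp_product_component(1)[OF x] Zp_product_component(2)[OF x]
    by (auto simp: A_hat_proj_def A_ring_simps(1) A_trans_coset)
next
  fix x y assume x: "x \<in> carrier (product_ring primes Zp)" and y: "y \<in> carrier (product_ring primes Zp)"
  have 1: "(\<lambda>p\<in>primes. (x \<otimes>\<^bsub>product_ring primes Zp\<^esub> y) p n) =
      (\<lambda>p\<in>primes. x p n) \<otimes>\<^bsub>prod_Zmod n\<^esub> (\<lambda>p\<in>primes. y p n)" if "1 \<le> n" for n
    unfolding product_ring_simps(2) prod_Zmod_simps(2) using that
    by (intro restrict_ext) (simp add: Zp_def proj_limit_simps)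
  have 2: "(\<lambda>p\<in>primes. (x \<oplus>\<^bsub>product_ring primes Zp\<^esub> y) p n) =
      (\<lambda>p\<in>primes. x p n) \<oplus>\<^bsub>prod_Zmod n\<^esub> (\<lambda>p\<in>primes. y p n)" if "1 \<le> n" for n
    unfolding product_ring_simps(3) prod_Zmod_simps(3) using that
    by (intro restrict_ext) (simp add: Zp_def proj_limit_simps)
  show "A_hat_proj (x \<otimes>\<^bsub>product_ring primes Zp\<^esub> y) = A_hat_proj x \<otimes>\<^bsub>A_hat\<^esub> A_hat_proj y"
    unfolding A_hat_def proj_limit_simps A_hat_proj_def
    by (intro restrict_ext)
       (simp add: 1 A_ring_mult Zp_product_component(1)[OF x] Zp_product_component(1)[OF y])
  show "A_hat_proj (x \<oplus>\<^bsub>product_ring primes Zp\<^esub> y) = A_hat_proj x \<oplus>\<^bsub>A_hat\<^esub> A_hat_proj y"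
    unfolding A_hat_def proj_limit_simps A_hat_proj_def
    by (intro restrict_ext)
       (simp add: 2 A_ring_add Zp_product_component(1)[OF x] Zp_product_component(1)[OF y])
next
  have "(\<lambda>p\<in>primes. \<one>\<^bsub>product_ring primes Zp\<^esub> p n) = \<one>\<^bsub>prod_Zmod n\<^esub>" if "1 \<le> n" for n
    unfolding product_ring_simps(4) prod_Zmod_simps(4) using that
    by (intro restrict_ext) (simp add: Zp_def proj_limit_simps)
  then show "A_hat_proj \<one>\<^bsub>product_ring primes Zp\<^esub> = \<one>\<^bsub>A_hat\<^esub>"
    unfolding A_hat_def proj_limit_simps A_hat_proj_def
    by (intro restrict_ext) (simp add: A_ring_simps(2))
qed

lemma A_hat_sums_unique:
  assumes "A_hat_sums f s" "A_hat_sums f s'"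
  shows "s = s'"
proof -
  have "Hausdorff_space A_hat_topology"
    unfolding A_hat_topology_def
    by (intro Hausdorff_space_subtopology)
       (simp add: Hausdorff_space_product_topology Hausdorff_space_discrete_topology)
  then show ?thesis
    using assms unfolding A_hat_sums_def by (metis limitin_Hausdorff_unique sequentially_bot)
qed

lemma A_hat_suminf_eqI: "A_hat_sums f s \<Longrightarrow> A_hat_suminf f = s"
  unfolding A_hat_suminf_def using A_hat_sums_unique by blast

lemma residue_mult_unique:
  fixes a b :: int
  assumes "coprime b m" "0 < m"
  shows "b * (a * modular_inverse m b mod m) mod m = a mod m"
proof -
  have "[a * (b * modular_inverse m b) = a * 1] (mod m)"
    by (intro cong_mult cong_refl cong_modular_inverse1 assms)
  then show ?thesis by (simp add: cong_def mod_simps algebra_simps)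
qed

lemma rat_to_Zp_closed:
  assumes p: "prime p" and r: "\<not> int p dvd snd (quotient_of r)"
  shows "rat_to_Zp p r \<in> carrier (Zp p)"
proof -
  obtain a b where q: "quotient_of r = (a, b)" by fastforce
  have "coprime (int p) b"
    using p r q by (intro prime_imp_coprime) auto
  then have cop: "coprime b (int p ^ n)" for n
    by (simp add: coprime_commute)
  have pos: "0 < int p ^ n" for n using prime_gt_0_nat[OF p] by simp
  have "a * modular_inverse (int p ^ Suc n) b mod int p ^ Suc n mod int p ^ n =
      a * modular_inverse (int p ^ n) b mod int p ^ n" for n
  proof -
    let ?c = "a * modular_inverse (int p ^ Suc n) b mod int p ^ Suc n"
    have d: "int p ^ n dvd int p ^ Suc n" by simp
    have "b * ?c mod int p ^ n = a mod int p ^ n"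
      using residue_mult_unique[OF cop[of "Suc n"] pos[of "Suc n"], of a] mod_mod_cancel[OF d]
      by metis
    then have "[b * ?c = b * (a * modular_inverse (int p ^ n) b mod int p ^ n)] (mod int p ^ n)"
      using residue_mult_unique[OF cop[of n] pos[of n], of a] by (simp only: cong_def)
    then have "[?c = a * modular_inverse (int p ^ n) b mod int p ^ n] (mod int p ^ n)"
      using cop by (simp only: cong_mult_lcancel)
    then show ?thesis by (simp only: cong_def mod_mod_trivial)
  qed
  then show ?thesis
    using prime_gt_0_nat[OF p]
    by (auto simp: Zp_def proj_limit_carrier rat_to_Zp_def q residue_ring_def simp del: power_Suc)
qed

lemma rat_to_Zp_char:
  assumes p: "prime p" and r: "\<not> int p dvd snd (quotient_of r)" and n: "1 \<le> n"
  shows "[snd (quotient_of r) * rat_to_Zp p r n = fst (quotient_of r)] (mod int p ^ n)"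
proof -
  have "coprime (snd (quotient_of r)) (int p ^ n)"
    using p r by (simp add: coprime_commute prime_imp_coprime)
  moreover have "0 < int p ^ n" using prime_gt_0_nat[OF p] by simp
  ultimately show ?thesis
    using residue_mult_unique n by (simp add: rat_to_Zp_def case_prod_beta cong_def)
qed

end

theory Submission
  imports Defs
begin

text \<open>Let \<open>s\<^bsub>k\<^esub>(n)\<close> be the part of \<open>\<zeta>\<^sup>\<star>\<^bsub>n\<^esub>(k)\<close> with first summation variable equal to \<open>n\<close>.
  Modulo high powers of \<open>p\<close> one has \<open>\<Sum>\<^sub>i \<zeta>\<^sup>\<star>\<^bsub>p-1\<^esub>({1}\<^sup>i, k) p\<^sup>i = \<Sum>\<^sub>a s\<^bsub>k\<^esub>(a) \<Prod>\<^sub>j (1 - p/j)\<^sup>-\<^sup>1\<close>,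
  where \<open>1 \<le> a \<le> p - 1\<close> and \<open>a \<le> j \<le> p - 1\<close>. For odd \<open>p\<close> the product is
  \<open>(-1)\<^bsup>a-1\<^esup> (p-1 choose a-1)\<close>. The binomial transform exchanges \<open>s\<^bsub>k\<^esub>\<close> with the function \<open>s\<close> of the
  Hoffman dual, because it intertwines the two operators that prepend \<open>0\<close> and \<open>1\<close> to the word of \<open>k\<close>.
  Completing the sum by the term \<open>a = p\<close> shows that it equals \<open>s\<^bsub>k\<or>\<^esub>(p) - s\<^bsub>k\<^esub>(p)\<close>, which is
  antisymmetric under duality.\<close>

section \<open>Binomial duality of multiple harmonic star sums\<close>

lemma zeta_star_Nil: "zeta_star n [] = 1"
proof -
  have "{ns. length ns = length [] \<and> set ns \<subseteq> {1..n} \<and> sorted_wrt (\<ge>) ns} = {[]}"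
    by auto
  then show ?thesis by (simp add: zeta_star_def)
qed

text \<open>Grouping the tuples by their first and largest entry \<open>j\<close> leaves the weakly
  decreasing tuples with entries in \<open>{1..j}\<close>.\<close>

lemma zeta_star_Cons:
  "zeta_star n (a # k) = (\<Sum>j=1..n. zeta_star j k / of_nat j ^ a)"
proof -
  define D where "D m l = {ns. length ns = l \<and> set ns \<subseteq> {1..m} \<and> sorted_wrt (\<ge>) ns}" for m l :: nat
  have fin: "finite (D m l)" for m l
    by (rule finite_subset[OF _ finite_lists_length_eq[of "{1..m}" l]]) (auto simp: D_def)
  have D_Suc: "D n (Suc l) = (\<lambda>(j, ns). j # ns) ` (SIGMA j:{1..n}. D j l)" for l
  proof (intro equalityI subsetI)
    fix ns assume "ns \<in> D n (Suc l)"
    then obtain j ms where "ns = j # ms" "j \<in> {1..n}" "ms \<in> D j l"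
      by (cases ns) (auto simp: D_def subset_iff)
    then show "ns \<in> (\<lambda>(j, ns). j # ns) ` (SIGMA j:{1..n}. D j l)" by force
  next
    fix ns assume "ns \<in> (\<lambda>(j, ns). j # ns) ` (SIGMA j:{1..n}. D j l)"
    then show "ns \<in> D n (Suc l)" by (fastforce simp: D_def)
  qed
  have "zeta_star n (a # k) =
      (\<Sum>ns\<in>D n (Suc (length k)). \<Prod>i<Suc (length k). 1 / of_nat (ns ! i) ^ ((a # k) ! i))"
    by (simp add: zeta_star_def D_def)
  also have "\<dots> = (\<Sum>(j, ns)\<in>(SIGMA j:{1..n}. D j (length k)).
      \<Prod>i<Suc (length k). 1 / of_nat ((j # ns) ! i) ^ ((a # k) ! i))"
    unfolding D_Suc by (subst sum.reindex) (auto simp: inj_on_def case_prod_beta)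
  also have "\<dots> = (\<Sum>j=1..n. \<Sum>ns\<in>D j (length k).
      \<Prod>i<Suc (length k). 1 / of_nat ((j # ns) ! i) ^ ((a # k) ! i))"
    using fin by (subst sum.Sigma) auto
  also have "\<dots> = (\<Sum>j=1..n. zeta_star j k / of_nat j ^ a)"
    by (simp add: prod.lessThan_Suc_shift zeta_star_def D_def sum_divide_distrib sum_distrib_left
        del: prod.lessThan_Suc)
  finally show ?thesis .
qed

lemma zeta_star_Suc_Cons:
  "zeta_star (Suc n) (a # k) = zeta_star n (a # k) + zeta_star (Suc n) k / of_nat (Suc n) ^ a"
  by (simp add: zeta_star_Cons)

section \<open>The binomial transform, division by m + 1 and partial sums\<close>

definition binomial_transform :: "(nat \<Rightarrow> rat) \<Rightarrow> nat \<Rightarrow> rat" where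
  "binomial_transform f m = (\<Sum>j\<le>m. (- 1) ^ j * of_nat (m choose j) * f j)"

text \<open>Absorption: (m + 1) C(m, j) = (j + 1) C(m + 1, j + 1). Both letters of a word end in a
  division by m + 1, so both need this.\<close>

lemma binomial_transform_divide:
  "binomial_transform (\<lambda>j. f j / of_nat (Suc j)) m =
     (\<Sum>j\<le>m. (- 1) ^ j * of_nat (Suc m choose Suc j) * f j) / of_nat (Suc m)"
proof -
  have "of_nat (m choose j) / (of_nat (Suc j) :: rat) = of_nat (Suc m choose Suc j) / of_nat (Suc m)" for j
  proof -
    have "of_nat (Suc m) * of_nat (m choose j) = (of_nat (Suc m choose Suc j) * of_nat (Suc j) :: rat)"
      by (metis of_nat_mult Suc_times_binomial_eq)
    then show ?thesis by (simp add: frac_eq_eq mult.commute del: of_nat_Suc binomial_Suc_Suc)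
  qed
  then have "(- 1) ^ j * of_nat (m choose j) * (f j / of_nat (Suc j)) =
      (- 1) ^ j * of_nat (Suc m choose Suc j) * f j / of_nat (Suc m)" for j
    by (metis (no_types, opaque_lifting) times_divide_eq_left times_divide_eq_right mult.assoc mult.commute)
  then show ?thesis
    unfolding binomial_transform_def by (simp only: sum_divide_distrib)
qed

text \<open>After exchanging the sums this is the hockey-stick identity; the induction uses Pascal's
  rule.\<close>

lemma sum_binomial_transform:
  "(\<Sum>i\<le>m. binomial_transform f i) = (\<Sum>j\<le>m. (- 1) ^ j * of_nat (Suc m choose Suc j) * f j)"
proof (induction m)
  case 0
  show ?case by (simp add: binomial_transform_def)
next
  case (Suc m)
  have "(\<Sum>j\<le>Suc m. (- 1) ^ j * of_nat (Suc (Suc m) choose Suc j) * f j) =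
      binomial_transform f (Suc m) + (\<Sum>j\<le>Suc m. (- 1) ^ j * of_nat (Suc m choose Suc j) * f j)"
    by (simp add: binomial_transform_def sum.distrib[symmetric] algebra_simps
        binomial_Suc_Suc[of "Suc m"] del: binomial_Suc_Suc sum.atMost_Suc)
  also have "(\<Sum>j\<le>Suc m. (- 1) ^ j * of_nat (Suc m choose Suc j) * f j) =
      (\<Sum>j\<le>m. (- 1) ^ j * of_nat (Suc m choose Suc j) * f j)"
    by (simp add: binomial_eq_0 del: binomial_Suc_Suc)
  finally show ?case using Suc.IH by simp
qed

text \<open>Summation by parts: the coefficient of \<open>f i\<close> is an alternating tail of row
  m + 1 of Pascal's triangle, which telescopes to (-1)^i C(m, i).\<close>

lemma binomial_transform_partial_sums:
  "(\<Sum>j\<le>m. (- 1) ^ j * of_nat (Suc m choose Suc j) * (\<Sum>i\<le>j. f i)) = binomial_transform f m"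
proof -
  \<comment> \<open>Cutting off at an arbitrary \<open>l\<close> permits induction; the boundary
    term contains C(m, l + 1), which is 0 at l = m.\<close>
  have "(\<Sum>j\<le>l. (- 1) ^ j * of_nat (Suc m choose Suc j) * (\<Sum>i\<le>j. f i)) =
      (\<Sum>j\<le>l. (- 1) ^ j * of_nat (m choose j) * f j) +
      (- 1) ^ l * of_nat (m choose Suc l) * (\<Sum>i\<le>l. f i)" for l
    by (induction l) (simp_all add: algebra_simps)
  from this[of m] show ?thesis
    by (simp add: binomial_transform_def binomial_eq_0 del: binomial_Suc_Suc)
qed

text \<open>The argument is an index word without its final letter \<open>1\<close>; the value at \<open>m\<close> is the part of
  the multiple harmonic star sum whose largest summation variable is \<open>m + 1\<close>.\<close>

fun head_sum :: "bool list \<Rightarrow> nat \<Rightarrow> rat" where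
  "head_sum [] m = 1 / of_nat (Suc m)"
| "head_sum (False # u) m = head_sum u m / of_nat (Suc m)"
| "head_sum (True # u) m = (\<Sum>j\<le>m. head_sum u j) / of_nat (Suc m)"

text \<open>The transform turns division by m + 1 into partial summation followed by that division,
  and conversely. These are the operators of the letters 0 and 1, so each letter of the word is
  exchanged in turn.\<close>

theorem binomial_transform_head_sum:
  "binomial_transform (head_sum u) m = head_sum (map Not u) m"
proof (induction u arbitrary: m)
  case Nil
  \<comment> \<open>Dividing the constant 1 by m + 1 gives the empty word's function. The transform
    of 1 is the indicator of 0, with all partial sums 1, so this function is fixed.\<close>
  have delta: "binomial_transform (\<lambda>_. 1) i = (if i = 0 then 1 else 0)" for i
    using choose_alternating_sum[of i, where ?'a = rat] by (simp add: binomial_transform_def)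
  have "head_sum [] = (\<lambda>m. 1 / of_nat (Suc m))" by auto
  then have "binomial_transform (head_sum []) m =
      (\<Sum>i\<le>m. binomial_transform (\<lambda>_. 1) i) / of_nat (Suc m)"
    by (simp only: binomial_transform_divide sum_binomial_transform[symmetric])
  also have "\<dots> = head_sum (map Not []) m" by (simp add: delta)
  finally show ?case .
next
  case (Cons c u)
  have head: "head_sum (True # u) = (\<lambda>m. (\<Sum>j\<le>m. head_sum u j) / of_nat (Suc m))"
    "head_sum (False # u) = (\<lambda>m. head_sum u m / of_nat (Suc m))" by auto
  show ?case
  proof (cases c)
    case True
    then show ?thesis
      by (simp only: head binomial_transform_divide binomial_transform_partial_sums) (simp add: Cons.IH)
  next
    case False
    then show ?thesis
      by (simp only: head binomial_transform_divide sum_binomial_transform[symmetric])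
        (simp add: Cons.IH)
  qed
qed

section \<open>From words back to indices\<close>

lemma head_sum_replicate_False:
  "head_sum (replicate b False @ u) m = head_sum u m / of_nat (Suc m) ^ b"
  by (induction b) (simp_all add: field_simps del: of_nat_Suc)

text \<open>A letter 0 only divides by the current variable, while a 1 also opens the sum over the
  next one. The final 1, removed by \<open>butlast\<close>, survives as the value of
  \<open>head_sum []\<close>.\<close>

lemma head_sum_index_word:
  assumes "\<forall>b\<in>set (a # l). 1 \<le> b"
  shows "head_sum (butlast (index_word (a # l))) m = zeta_star (Suc m) l / of_nat (Suc m) ^ a"
  using assms
proof (induction l arbitrary: a m)
  case Nil
  then show ?case
    using head_sum_replicate_False[of "a - 1" "[]" m]
    by (cases a) (simp_all add: index_word_def zeta_star_Nil butlast_append field_simps del: of_nat_Suc)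
next
  case (Cons b l)
  have ne: "index_word (b # l) \<noteq> []" by (simp add: index_word_Cons)
  have IH: "head_sum (butlast (index_word (b # l))) j = zeta_star (Suc j) l / of_nat (Suc j) ^ b" for j
    using Cons by auto
  have "butlast (index_word (a # b # l)) = replicate (a - 1) False @ True # butlast (index_word (b # l))"
    using ne by (subst index_word_Cons) (simp add: butlast_append)
  \<comment> \<open>The \<open>a - 1\<close> letters 0 and the 1 after them together divide
    \<open>a\<close> times by m + 1.\<close>
  then have "head_sum (butlast (index_word (a # b # l))) m =
      (\<Sum>j\<le>m. zeta_star (Suc j) l / of_nat (Suc j) ^ b) / of_nat (Suc m) / of_nat (Suc m) ^ (a - 1)"
    by (simp add: head_sum_replicate_False IH del: of_nat_Suc)
  also have "(\<Sum>j\<le>m. zeta_star (Suc j) l / of_nat (Suc j) ^ b) = zeta_star (Suc m) (b # l)"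
    using sum.shift_bounds_cl_Suc_ivl[of "\<lambda>j. zeta_star j l / of_nat j ^ b" 0 m]
    by (simp add: zeta_star_Cons atMost_atLeast0 del: of_nat_Suc)
  finally show ?case
    using Cons.prems by (cases a) (simp_all add: field_simps del: of_nat_Suc)
qed

section \<open>Recursions in the upper limit and the generating sum in powers of p\<close>

lemma zeta_star_0:
  assumes "k \<noteq> []" shows "zeta_star 0 k = 0"
  using assms by (cases k) (simp_all add: zeta_star_Cons)

lemma zeta_star_Suc:
  assumes "is_index k"
  shows "zeta_star (Suc m) k = zeta_star m k + head_sum (butlast (index_word k)) m"
proof -
  obtain a l where "k = a # l" using assms by (cases k) (auto simp: is_index_def)
  then show ?thesis
    using assms by (simp only: zeta_star_Suc_Cons) (simp add: head_sum_index_word is_index_def)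
qed

text \<open>The binomial transform cut off at \<open>M\<close>. For n = M = p - 1 it omits only the
  term j = p - 1, whose denominators involve p.\<close>

definition alt_head_sum :: "nat list \<Rightarrow> nat \<Rightarrow> nat \<Rightarrow> rat" where
  "alt_head_sum k n M = (\<Sum>j<M. (- 1) ^ j * of_nat (n choose j) * head_sum (butlast (index_word k)) j)"

text \<open>The omitted term j = n has sign +1 for even n. Hence the sum is s'(n) - s(n), with s and
  s' the head sums of \<open>k\<close> and of its dual, and passing to the dual swaps s and
  s'.\<close>

lemma alt_head_sum_hoffman_dual:
  assumes "even n"
  shows "alt_head_sum (hoffman_dual k) n n = - alt_head_sum k n n"
proof -
  have alt: "alt_head_sum l n n = binomial_transform (head_sum (butlast (index_word l))) n -
      head_sum (butlast (index_word l)) n" for l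
    using assms by (simp add: alt_head_sum_def binomial_transform_def lessThan_Suc_atMost[symmetric])
  have "butlast (index_word (hoffman_dual k)) = map Not (butlast (index_word k))"
    using hoffman_dual by simp
  then show ?thesis by (simp add: alt binomial_transform_head_sum o_def)
qed

text \<open>For i > 0, raising the upper limit to M + 1 adds the value for one fewer leading 1,
  divided by M + 1. The weighted sum of these increments is x / (M + 1) times the left side without
  its top term.\<close>

lemma sum_zeta_star_Suc:
  assumes "is_index k"
  shows "(\<Sum>i\<le>N. zeta_star (Suc M) (replicate i 1 @ k) * x ^ i) =
    (\<Sum>i\<le>N. zeta_star M (replicate i 1 @ k) * x ^ i) + head_sum (butlast (index_word k)) M +
    x / of_nat (Suc M) * ((\<Sum>i\<le>N. zeta_star (Suc M) (replicate i 1 @ k) * x ^ i) -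
      x ^ N * zeta_star (Suc M) (replicate N 1 @ k))"
proof (induction N)
  case 0
  then show ?case by (simp add: zeta_star_Suc[OF assms])
next
  case (Suc N)
  \<comment> \<open>Here \<open>A\<close> and \<open>B\<close> are the two sums up to
    \<open>N\<close>, \<open>a\<close> and \<open>b\<close> their next coefficients,
    \<open>z\<close> is the coefficient in \<open>A\<close> preceding \<open>a\<close>,
    \<open>q\<close> is x^N and \<open>y\<close> is M + 1.\<close>
  have step: "A + a * (x * q) = B + b * (x * q) + h + x / y * (A + a * (x * q) - x * q * a)"
    if "A = B + h + x / y * (A - q * z)" "a = b + z / y" for A B a b q z h y :: rat
  proof -
    have "a * (x * q) = b * (x * q) + x / y * (q * z)" by (simp add: that(2) algebra_simps)
    moreover have "A = B + h + (x / y * A - x / y * (q * z))"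
      using that(1) by (simp only: right_diff_distrib)
    moreover have cancel: "A + a * (x * q) - x * q * a = A" by simp
    ultimately show ?thesis unfolding cancel by linarith
  qed
  have "zeta_star (Suc M) (replicate (Suc N) 1 @ k) =
     zeta_star M (replicate (Suc N) 1 @ k) + zeta_star (Suc M) (replicate N 1 @ k) / of_nat (Suc M)"
    by (simp add: zeta_star_Suc_Cons)
  with Suc show ?case unfolding sum.atMost_Suc power_Suc by (rule step)
qed

text \<open>As \<open>N\<close> grows, the factor \<open>(Suc n) ^ Suc N\<close> makes the last term \<open>p\<close>-adically small for
  \<open>p = Suc n\<close>.\<close>

lemma sum_zeta_star_eq:
  assumes k: "is_index k"
  shows "(- 1) ^ M * of_nat (n choose M) *
      (\<Sum>i\<le>N. zeta_star M (replicate i 1 @ k) * of_nat (Suc n) ^ i) =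
    alt_head_sum k n M -
    of_nat (Suc n) ^ Suc N * (\<Sum>j<M. (- 1) ^ j * of_nat (n choose j) *
      zeta_star (Suc j) (replicate N 1 @ k) * (1 / of_nat (Suc j)))"
proof (induction M)
  case 0
  have "k \<noteq> []" using k by (simp add: is_index_def)
  then show ?case by (simp add: alt_head_sum_def zeta_star_0)
next
  case (Suc M)
  define G where "G m = (\<Sum>i\<le>N. zeta_star m (replicate i 1 @ k) * of_nat (Suc n) ^ i)" for m
  define W where "W m = (\<Sum>j<m. (- 1) ^ j * of_nat (n choose j) *
    zeta_star (Suc j) (replicate N 1 @ k) * (1 / of_nat (Suc j)))" for m
  define h where "h = head_sum (butlast (index_word k)) M"
  define z where "z = zeta_star (Suc M) (replicate N 1 @ k)"
  define x y c where "x = (of_nat (Suc n) :: rat)" and "y = (of_nat (Suc M) :: rat)"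
    and "c = (- 1) ^ M * (of_nat (n choose M) :: rat)"
  have G: "G (Suc M) = G M + h + x / y * (G (Suc M) - x ^ N * z)"
    unfolding G_def h_def z_def x_def y_def by (rule sum_zeta_star_Suc[OF k])
  \<comment> \<open>For x = n + 1 the signed binomial prefactor grows by exactly 1 - x / (M + 1),
    the factor of the new generating sum in \<open>G\<close>.\<close>
  have "of_nat (Suc M) * of_nat (n choose Suc M) + of_nat (Suc M) * of_nat (n choose M) =
      (of_nat (Suc n) * of_nat (n choose M) :: rat)"
    using Suc_times_binomial_eq[of n M, THEN arg_cong, of "of_nat :: nat \<Rightarrow> rat"]
    by (simp add: algebra_simps)
  then have "y * of_nat (n choose Suc M) = (x - y) * of_nat (n choose M)"
    by (simp add: x_def y_def algebra_simps)
  then have choose: "of_nat (n choose Suc M) = (x / y - 1) * of_nat (n choose M)"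
    by (simp add: y_def field_simps)
  have "(- 1) ^ Suc M * of_nat (n choose Suc M) * G (Suc M) =
      c * (G (Suc M) - x / y * G (Suc M))"
    unfolding choose by (simp add: c_def algebra_simps)
  also have "G (Suc M) - x / y * G (Suc M) = G M + h - x ^ Suc N * z * (1 / y)"
  proof -
    have "x / y * (x ^ N * z) = x ^ Suc N * z * (1 / y)" by simp
    with G show ?thesis unfolding right_diff_distrib by linarith
  qed
  finally have G_Suc: "(- 1) ^ Suc M * of_nat (n choose Suc M) * G (Suc M) =
      c * (G M + h - x ^ Suc N * z * (1 / y))" .
  have alt_Suc: "alt_head_sum k n (Suc M) = alt_head_sum k n M + c * h"
    by (simp add: alt_head_sum_def c_def h_def)
  have W_Suc: "W (Suc M) = W M + c * z * (1 / y)"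
    by (simp add: W_def c_def z_def y_def)
  have expand: "c * (g + h - X * z * t) = a + c * h - X * (w + c * z * t)"
    if "c * g = a - X * w" for a c g h t w z X :: rat
    using that by (simp add: algebra_simps)
  have "c * G M = alt_head_sum k n M - x ^ Suc N * W M"
    unfolding c_def G_def x_def W_def by (rule Suc.IH)
  then have "(- 1) ^ Suc M * of_nat (n choose Suc M) * G (Suc M) =
      alt_head_sum k n (Suc M) - x ^ Suc N * W (Suc M)"
    unfolding G_Suc alt_Suc W_Suc by (rule expand)
  then show ?case unfolding G_def W_def x_def .
qed

section \<open>Rationals that are integral at p\<close>

text \<open>\<open>is_pintegral p r\<close> says that \<open>r\<close> lies in the localisation of the integers at \<open>p\<close>; this is the range
  in which \<open>rat_to_Zp p\<close> is meaningful.\<close>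

definition is_pintegral :: "nat \<Rightarrow> rat \<Rightarrow> bool" where
  "is_pintegral p r \<longleftrightarrow> \<not> int p dvd snd (quotient_of r)"

lemma is_pintegral_fracE:
  assumes "is_pintegral p r"
  obtains a b where "r = of_int a / of_int b" "\<not> int p dvd b"
  using assms quotient_of_div[of r] unfolding is_pintegral_def by (metis prod.collapse)

lemma quotient_of_cross_mult:
  assumes "r = of_int a / of_int b" "b \<noteq> 0"
  shows "fst (quotient_of r) * b = a * snd (quotient_of r)"
proof -
  obtain c d where q: "quotient_of r = (c, d)" by fastforce
  have "of_int c / of_int d = (of_int a / of_int b :: rat)" "d \<noteq> 0"
    using quotient_of_div[OF q] quotient_of_denom_pos[OF q] assms by auto
  then have "(of_int (c * b) :: rat) = of_int (a * d)"
    using assms by (simp add: frac_eq_eq)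
  then show ?thesis unfolding q fst_conv snd_conv by (simp only: of_int_eq_iff)
qed

text \<open>The reduced denominator divides every other denominator, so any fraction prime to
  \<open>p\<close> below certifies integrality.\<close>

lemma is_pintegral_frac:
  assumes "r = of_int a / of_int b" "\<not> int p dvd b"
  shows "is_pintegral p r"
proof -
  obtain c d where q: "quotient_of r = (c, d)" by fastforce
  have "b \<noteq> 0" using assms by auto
  from quotient_of_cross_mult[OF assms(1) this] have "d dvd c * b" unfolding q by simp
  moreover have "coprime d c" using quotient_of_coprime[OF q] by (simp add: coprime_commute)
  ultimately have "d dvd b" by (simp add: coprime_dvd_mult_right_iff)
  then show ?thesis using assms(2) dvd_trans by (auto simp: is_pintegral_def q)
qed

lemma is_pintegral_of_int: "prime p \<Longrightarrow> is_pintegral p (of_int a)"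
  by (rule is_pintegral_frac[of _ a 1]) (auto dest: prime_gt_1_nat)

lemma is_pintegral_of_nat: "prime p \<Longrightarrow> is_pintegral p (of_nat a)"
  using is_pintegral_of_int[of p "int a"] by simp

lemma is_pintegral_inverse:
  assumes "0 < a" "a < p"
  shows "is_pintegral p (1 / of_nat a)"
  by (rule is_pintegral_frac[of _ 1 "int a"]) (use assms in \<open>auto dest: nat_dvd_not_less\<close>)

lemma is_pintegral_add:
  assumes p: "prime p" and "is_pintegral p r" "is_pintegral p s"
  shows "is_pintegral p (r + s)"
proof -
  obtain a b c d where r: "r = of_int a / of_int b" "\<not> int p dvd b"
    and s: "s = of_int c / of_int d" "\<not> int p dvd d"
    using assms(2,3) by (meson is_pintegral_fracE)
  have "b \<noteq> 0" "d \<noteq> 0" using r s by auto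
  show ?thesis
    by (rule is_pintegral_frac[of _ "a * d + c * b" "b * d"])
      (use p r s \<open>b \<noteq> 0\<close> \<open>d \<noteq> 0\<close> in \<open>simp_all add: prime_dvd_mult_iff add_frac_eq\<close>)
qed

lemma is_pintegral_mult:
  assumes p: "prime p" and "is_pintegral p r" "is_pintegral p s"
  shows "is_pintegral p (r * s)"
proof -
  obtain a b c d where r: "r = of_int a / of_int b" "\<not> int p dvd b"
    and s: "s = of_int c / of_int d" "\<not> int p dvd d"
    using assms(2,3) by (meson is_pintegral_fracE)
  show ?thesis
    by (rule is_pintegral_frac[of _ "a * c" "b * d"]) (use p r s in \<open>simp_all add: prime_dvd_mult_iff\<close>)
qed

lemma is_pintegral_sum:
  assumes "prime p" "\<And>i. i \<in> I \<Longrightarrow> is_pintegral p (f i)"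
  shows "is_pintegral p (\<Sum>i\<in>I. f i)"
  using assms is_pintegral_of_nat[OF assms(1), of 0]
  by (induction I rule: infinite_finite_induct) (auto intro: is_pintegral_add)

lemma is_pintegral_power:
  assumes "prime p" "is_pintegral p r"
  shows "is_pintegral p (r ^ n)"
  using assms is_pintegral_of_nat[OF assms(1), of 1]
  by (induction n) (auto intro: is_pintegral_mult)

lemma is_pintegral_zeta_star:
  assumes p: "prime p" and "n < p"
  shows "is_pintegral p (zeta_star n k)"
  using assms(2)
proof (induction k arbitrary: n)
  case Nil
  then show ?case using is_pintegral_of_nat[OF p, of 1] by (simp add: zeta_star_Nil)
next
  case (Cons a k)
  have "is_pintegral p (zeta_star j k * (1 / of_nat j) ^ a)" if "j \<in> {1..n}" for j
    using that Cons p
    by (intro is_pintegral_mult is_pintegral_power is_pintegral_inverse) auto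
  then show ?case
    unfolding zeta_star_Cons by (intro is_pintegral_sum p) (auto simp: power_one_over)
qed

text \<open>All variables of the sum are at most m + 1. The bound stops at m = p - 2, because
  \<open>head_sum u (p - 1)\<close> divides by \<open>p\<close>.\<close>

lemma is_pintegral_head_sum:
  assumes p: "prime p" and "Suc m < p"
  shows "is_pintegral p (head_sum u m)"
  using assms(2)
proof (induction u arbitrary: m)
  case Nil
  then show ?case using is_pintegral_inverse[of "Suc m" p] by simp
next
  case (Cons c u)
  have "is_pintegral p (r * (1 / of_nat (Suc m)))" if "is_pintegral p r" for r
    using that Cons p is_pintegral_inverse[of "Suc m" p] by (intro is_pintegral_mult) auto
  note divide = this
  show ?case
  proof (cases c)
    case True
    have "is_pintegral p (\<Sum>j\<le>m. head_sum u j)"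
      using Cons p by (intro is_pintegral_sum) auto
    from divide[OF this] True show ?thesis by simp
  next
    case False
    from divide[OF Cons.IH[OF Cons.prems]] False show ?thesis by simp
  qed
qed

lemma is_pintegral_alternating_binomial:
  assumes "prime p" shows "is_pintegral p ((- 1) ^ j * of_nat (n choose j))"
  using is_pintegral_of_int[OF assms, of "(- 1) ^ j * int (n choose j)"] by simp

lemma is_pintegral_alt_head_sum:
  assumes p: "prime p" and "M < p"
  shows "is_pintegral p (alt_head_sum k n M)"
  unfolding alt_head_sum_def using assms
  by (intro is_pintegral_sum is_pintegral_mult[OF p] is_pintegral_alternating_binomial
      is_pintegral_head_sum) auto

section \<open>Residues of p-integral rationals modulo powers of p\<close>

text \<open>Both \<open>b\<close> and the reduced denominator are units modulo p^n, so
  cross-multiplication is reversible. The sum and product rules can then use unreduced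
  fractions.\<close>

lemma rat_to_Zp_cong_iff:
  assumes p: "prime p" and r: "r = of_int a / of_int b" "\<not> int p dvd b" and n: "1 \<le> n"
  shows "[x = rat_to_Zp p r n] (mod int p ^ n) \<longleftrightarrow> [b * x = a] (mod int p ^ n)"
proof -
  obtain c d where q: "quotient_of r = (c, d)" by fastforce
  have d: "\<not> int p dvd d" using is_pintegral_frac[OF r] by (simp add: is_pintegral_def q)
  have cop: "coprime e (int p ^ n)" if "\<not> int p dvd e" for e
    using p that prime_imp_coprime[of "int p" e] by (simp add: coprime_commute)
  have "b \<noteq> 0" using r by auto
  from quotient_of_cross_mult[OF r(1) this] have cross: "c * b = a * d" by (simp add: q)
  have v: "[d * rat_to_Zp p r n = c] (mod int p ^ n)"
    using rat_to_Zp_char[OF p _ n, of r] d by (simp add: q)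
  have "[x = rat_to_Zp p r n] (mod int p ^ n) \<longleftrightarrow> [b * d * x = b * d * rat_to_Zp p r n] (mod int p ^ n)"
    using cop[OF r(2)] cop[OF d]
    by (intro cong_mult_lcancel[symmetric]) (simp only: coprime_mult_left_iff)
  also have "\<dots> \<longleftrightarrow> [b * d * x = b * c] (mod int p ^ n)"
    using cong_scalar_left[OF v, of b] by (metis cong_sym cong_trans mult.assoc)
  also have "\<dots> \<longleftrightarrow> [d * (b * x) = d * a] (mod int p ^ n)"
    using cross by (simp add: mult.commute mult.left_commute)
  also have "\<dots> \<longleftrightarrow> [b * x = a] (mod int p ^ n)"
    using cop[OF d] by (simp add: cong_mult_lcancel)
  finally show ?thesis .
qed

lemma rat_to_Zp_mod: "1 \<le> n \<Longrightarrow> rat_to_Zp p r n mod int p ^ n = rat_to_Zp p r n"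
  by (simp add: rat_to_Zp_def case_prod_beta)

lemma rat_to_Zp_add:
  assumes p: "prime p" and "is_pintegral p r" "is_pintegral p s" and n: "1 \<le> n"
  shows "rat_to_Zp p (r + s) n = (rat_to_Zp p r n + rat_to_Zp p s n) mod int p ^ n"
proof -
  obtain a b c d where r: "r = of_int a / of_int b" "\<not> int p dvd b"
    and s: "s = of_int c / of_int d" "\<not> int p dvd d"
    using assms(2,3) by (meson is_pintegral_fracE)
  have "b \<noteq> 0" "d \<noteq> 0" using r s by auto
  then have rs: "r + s = of_int (a * d + c * b) / of_int (b * d)" "\<not> int p dvd b * d"
    using p r s by (simp_all add: prime_dvd_mult_iff add_frac_eq)
  have "[b * rat_to_Zp p r n = a] (mod int p ^ n)" "[d * rat_to_Zp p s n = c] (mod int p ^ n)"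
    using rat_to_Zp_cong_iff[OF p r n, THEN iffD1, OF cong_refl]
      rat_to_Zp_cong_iff[OF p s n, THEN iffD1, OF cong_refl] by auto
  then have "[d * (b * rat_to_Zp p r n) + b * (d * rat_to_Zp p s n) = d * a + b * c] (mod int p ^ n)"
    by (intro cong_add cong_scalar_left)
  then have "[rat_to_Zp p r n + rat_to_Zp p s n = rat_to_Zp p (r + s) n] (mod int p ^ n)"
    unfolding rat_to_Zp_cong_iff[OF p rs n] by (simp add: algebra_simps)
  then show ?thesis by (simp add: cong_def rat_to_Zp_mod[OF n])
qed

lemma rat_to_Zp_mult:
  assumes p: "prime p" and "is_pintegral p r" "is_pintegral p s" and n: "1 \<le> n"
  shows "rat_to_Zp p (r * s) n = (rat_to_Zp p r n * rat_to_Zp p s n) mod int p ^ n"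
proof -
  obtain a b c d where r: "r = of_int a / of_int b" "\<not> int p dvd b"
    and s: "s = of_int c / of_int d" "\<not> int p dvd d"
    using assms(2,3) by (meson is_pintegral_fracE)
  then have rs: "r * s = of_int (a * c) / of_int (b * d)" "\<not> int p dvd b * d"
    using p by (simp_all add: prime_dvd_mult_iff)
  have "[b * rat_to_Zp p r n = a] (mod int p ^ n)" "[d * rat_to_Zp p s n = c] (mod int p ^ n)"
    using rat_to_Zp_cong_iff[OF p r n, THEN iffD1, OF cong_refl]
      rat_to_Zp_cong_iff[OF p s n, THEN iffD1, OF cong_refl] by auto
  then have "[(b * rat_to_Zp p r n) * (d * rat_to_Zp p s n) = a * c] (mod int p ^ n)"
    by (rule cong_mult)
  then have "[rat_to_Zp p r n * rat_to_Zp p s n = rat_to_Zp p (r * s) n] (mod int p ^ n)"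
    unfolding rat_to_Zp_cong_iff[OF p rs n] by (simp add: algebra_simps)
  then show ?thesis by (simp add: cong_def rat_to_Zp_mod[OF n])
qed

text \<open>Write r = a / b; then 0 solves \<open>b * x = p^N * a\<close> modulo p^n. This removes
  the remainder of the truncated series.\<close>

lemma rat_to_Zp_power_multiple:
  assumes p: "prime p" and r: "is_pintegral p r" and n: "1 \<le> n" "n \<le> N"
  shows "rat_to_Zp p (of_nat p ^ N * r) n = 0"
proof -
  obtain a b where "r = of_int a / of_int b" and b: "\<not> int p dvd b"
    using r by (rule is_pintegral_fracE)
  then have eq: "of_nat p ^ N * r = of_int (int p ^ N * a) / of_int b" by simp
  have "[b * 0 = int p ^ N * a] (mod int p ^ n)"
    using n by (simp add: cong_0_iff cong_sym_eq[of 0] le_imp_power_dvd)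
  then have "[0 = rat_to_Zp p (of_nat p ^ N * r) n] (mod int p ^ n)"
    unfolding rat_to_Zp_cong_iff[OF p eq b n(1)] .
  then show ?thesis by (simp add: cong_def rat_to_Zp_mod[OF n(1)])
qed

section \<open>Convergence in the ring \<open>\<A>\<close>-hat\<close>

definition rat_family_hat :: "(nat \<Rightarrow> rat) \<Rightarrow> nat \<Rightarrow> (nat \<Rightarrow> int) set" where
  "rat_family_hat f = A_hat_proj (\<lambda>p\<in>primes. rat_to_Zp p (f p))"

text \<open>Integrality is imposed at every prime, so that each component lies in
  \<open>Zp p\<close> and \<open>A_hat_proj_hom\<close> applies.\<close>

definition pintegral_family :: "(nat \<Rightarrow> rat) \<Rightarrow> bool" where
  "pintegral_family f \<longleftrightarrow> (\<forall>p. prime p \<longrightarrow> is_pintegral p (f p))"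

lemma pintegral_family_add:
  "pintegral_family f \<Longrightarrow> pintegral_family g \<Longrightarrow> pintegral_family (\<lambda>p. f p + g p)"
  by (simp add: pintegral_family_def is_pintegral_add)

lemma pintegral_family_mult:
  "pintegral_family f \<Longrightarrow> pintegral_family g \<Longrightarrow> pintegral_family (\<lambda>p. f p * g p)"
  by (simp add: pintegral_family_def is_pintegral_mult)

lemma pintegral_family_sum:
  "(\<And>i. i \<in> I \<Longrightarrow> pintegral_family (f i)) \<Longrightarrow> pintegral_family (\<lambda>p. \<Sum>i\<in>I. f i p)"
  by (simp add: pintegral_family_def is_pintegral_sum)

lemma pintegral_family_of_nat: "pintegral_family (\<lambda>p. of_nat (g p))"
  by (simp add: pintegral_family_def is_pintegral_of_nat)

lemma pintegral_family_zeta_star: "pintegral_family (\<lambda>p. zeta_star (p - 1) k)"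
  by (auto simp: pintegral_family_def prime_gt_0_nat intro: is_pintegral_zeta_star)

lemma rat_to_Zp_family_closed:
  assumes "pintegral_family f"
  shows "(\<lambda>p\<in>primes. rat_to_Zp p (f p)) \<in> carrier (product_ring primes Zp)"
  using assms by (auto simp: product_ring_simps pintegral_family_def is_pintegral_def intro: rat_to_Zp_closed)

lemma rat_family_hat_closed:
  "pintegral_family f \<Longrightarrow> rat_family_hat f \<in> carrier A_hat"
  unfolding rat_family_hat_def
  by (rule ring_hom_closed[OF A_hat_proj_hom rat_to_Zp_family_closed])

lemma rat_family_hat_add:
  assumes "pintegral_family f" "pintegral_family g"
  shows "rat_family_hat (\<lambda>p. f p + g p) = rat_family_hat f \<oplus>\<^bsub>A_hat\<^esub> rat_family_hat g"
proof -
  have "rat_to_Zp p (f p + g p) = rat_to_Zp p (f p) \<oplus>\<^bsub>Zp p\<^esub> rat_to_Zp p (g p)" if "prime p" for p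
  proof
    fix n
    \<comment> \<open>At n = 0 both sides are \<open>undefined\<close>, since the levels start at
      1.\<close>
    show "rat_to_Zp p (f p + g p) n = (rat_to_Zp p (f p) \<oplus>\<^bsub>Zp p\<^esub> rat_to_Zp p (g p)) n"
      using assms that rat_to_Zp_add[of p "f p" "g p" n]
      by (cases "1 \<le> n") (auto simp: Zp_def proj_limit_simps residue_ring_def pintegral_family_def rat_to_Zp_def)
  qed
  then have "(\<lambda>p\<in>primes. rat_to_Zp p (f p + g p)) =
     (\<lambda>p\<in>primes. rat_to_Zp p (f p)) \<oplus>\<^bsub>product_ring primes Zp\<^esub> (\<lambda>p\<in>primes. rat_to_Zp p (g p))"
    unfolding product_ring_simps by (intro restrict_ext) simp
  then show ?thesis
    unfolding rat_family_hat_def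
    by (simp only: ring_hom_add[OF A_hat_proj_hom assms[THEN rat_to_Zp_family_closed]])
qed

lemma rat_family_hat_mult:
  assumes "pintegral_family f" "pintegral_family g"
  shows "rat_family_hat (\<lambda>p. f p * g p) = rat_family_hat f \<otimes>\<^bsub>A_hat\<^esub> rat_family_hat g"
proof -
  have "rat_to_Zp p (f p * g p) = rat_to_Zp p (f p) \<otimes>\<^bsub>Zp p\<^esub> rat_to_Zp p (g p)" if "prime p" for p
  proof
    fix n
    show "rat_to_Zp p (f p * g p) n = (rat_to_Zp p (f p) \<otimes>\<^bsub>Zp p\<^esub> rat_to_Zp p (g p)) n"
      using assms that rat_to_Zp_mult[of p "f p" "g p" n]
      by (cases "1 \<le> n") (auto simp: Zp_def proj_limit_simps residue_ring_def pintegral_family_def rat_to_Zp_def)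
  qed
  then have "(\<lambda>p\<in>primes. rat_to_Zp p (f p * g p)) =
     (\<lambda>p\<in>primes. rat_to_Zp p (f p)) \<otimes>\<^bsub>product_ring primes Zp\<^esub> (\<lambda>p\<in>primes. rat_to_Zp p (g p))"
    unfolding product_ring_simps by (intro restrict_ext) simp
  then show ?thesis
    unfolding rat_family_hat_def
    by (simp only: ring_hom_mult[OF A_hat_proj_hom assms[THEN rat_to_Zp_family_closed]])
qed

lemma rat_family_hat_0: "rat_family_hat (\<lambda>_. 0) = \<zero>\<^bsub>A_hat\<^esub>"
proof -
  interpret A: cring A_hat by (rule A_hat_cring)
  have 0: "pintegral_family (\<lambda>_. 0)" using pintegral_family_of_nat[of "\<lambda>_. 0"] by simp
  \<comment> \<open>Additivity gives z = z + z, which forces z = 0.\<close>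
  show ?thesis
    using rat_family_hat_add[OF 0 0] rat_family_hat_closed[OF 0] by simp
qed

lemma rat_family_hat_1: "rat_family_hat (\<lambda>_. 1) = \<one>\<^bsub>A_hat\<^esub>"
proof -
  have "rat_to_Zp p 1 = \<one>\<^bsub>Zp p\<^esub>" if p: "prime p" for p
  proof
    fix n
    have "rat_to_Zp p 1 n = 1" if n: "1 \<le> n"
    proof -
      have "1 < int p ^ n" using prime_gt_1_nat[OF p] n by (intro one_less_power) auto
      moreover have "[1 = rat_to_Zp p 1 n] (mod int p ^ n)"
        using prime_gt_1_nat[OF p] rat_to_Zp_cong_iff[OF p _ _ n, of 1 1 1 1] by auto
      ultimately show ?thesis by (simp add: cong_def rat_to_Zp_mod[OF n])
    qed
    then show "rat_to_Zp p 1 n = \<one>\<^bsub>Zp p\<^esub> n"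
      by (cases "1 \<le> n") (auto simp: Zp_def proj_limit_simps residue_ring_def rat_to_Zp_def)
  qed
  then have "(\<lambda>p\<in>primes. rat_to_Zp p 1) = \<one>\<^bsub>product_ring primes Zp\<^esub>"
    unfolding product_ring_simps by (intro restrict_ext) simp
  then show ?thesis
    unfolding rat_family_hat_def using ring_hom_one[OF A_hat_proj_hom] by simp
qed

lemma rat_family_hat_sum:
  assumes "finite I" "\<And>i. i \<in> I \<Longrightarrow> pintegral_family (f i)"
  shows "finsum A_hat (\<lambda>i. rat_family_hat (f i)) I = rat_family_hat (\<lambda>p. \<Sum>i\<in>I. f i p)"
proof -
  interpret A: cring A_hat by (rule A_hat_cring)
  show ?thesis
    using assms
  proof (induction I rule: finite_induct)
    case empty
    then show ?case by (simp add: rat_family_hat_0)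
  next
    case (insert i I)
    then have "finsum A_hat (\<lambda>i. rat_family_hat (f i)) (insert i I) =
        rat_family_hat (f i) \<oplus>\<^bsub>A_hat\<^esub> rat_family_hat (\<lambda>p. \<Sum>i\<in>I. f i p)"
      by (subst A.finsum_insert) (auto intro: rat_family_hat_closed)
    then show ?case
      using insert by (simp add: rat_family_hat_add pintegral_family_sum)
  qed
qed

text \<open>Elements of \<open>A_ring n\<close> are cosets of the families with finite support, so
  finitely many primes are invisible. The exceptional set may depend on \<open>n\<close>.\<close>

lemma rat_family_hat_component_eqI:
  assumes f: "pintegral_family f" and g: "pintegral_family g" and n: "1 \<le> n"
    and fin: "finite {p\<in>primes. rat_to_Zp p (f p) n \<noteq> rat_to_Zp p (g p) n}"
  shows "rat_family_hat f n = rat_family_hat g n"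
proof -
  interpret P: cring "prod_Zmod n" by (rule prod_Zmod_cring[OF n])
  interpret I: ideal "sum_Zmod n" "prod_Zmod n" by (rule sum_Zmod_ideal[OF n])
  define x where "x h = (\<lambda>p\<in>primes. rat_to_Zp p (h p) n)" for h
  have x_eq: "x h = (\<lambda>p\<in>primes. (\<lambda>p\<in>primes. rat_to_Zp p (h p)) p n)" for h
    by (auto simp: x_def)
  have "x h \<in> carrier (prod_Zmod n)" if "pintegral_family h" for h
    unfolding x_eq by (rule Zp_product_component(1)[OF rat_to_Zp_family_closed[OF that] n])
  note c = this[OF f] this[OF g]
  have comp: "rat_family_hat h n = sum_Zmod n +>\<^bsub>prod_Zmod n\<^esub> x h" for h
    using n by (simp add: rat_family_hat_def A_hat_proj_def x_eq)
  \<comment> \<open>This difference vanishes wherever the residues agree, hence lies in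
    \<open>sum_Zmod n\<close>.\<close>
  define y where "y = x f \<ominus>\<^bsub>prod_Zmod n\<^esub> x g"
  have yc: "y \<in> carrier (prod_Zmod n)" using c by (simp add: y_def)
  have yg: "y \<oplus>\<^bsub>prod_Zmod n\<^esub> x g = x f"
    using c by (simp add: y_def P.minus_eq P.a_assoc P.l_neg)
  have "y p = \<zero>\<^bsub>residue_ring (int p ^ n)\<^esub>" if p: "prime p" and "x f p = x g p" for p
  proof -
    interpret R: cring "residue_ring (int p ^ n)" using p n by (rule residue_ring_power_cring)
    have m: "z p \<in> carrier (residue_ring (int p ^ n))" if "z \<in> carrier (prod_Zmod n)" for z
      using that p by (auto simp: prod_Zmod_simps(1))
    have "y p \<oplus>\<^bsub>residue_ring (int p ^ n)\<^esub> x g p = x g p"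
      using fun_cong[OF yg, of p] that by (simp add: prod_Zmod_simps(3))
    then show ?thesis using m[OF yc] m[OF c(2)] by simp
  qed
  then have "{p\<in>primes. y p \<noteq> \<zero>\<^bsub>residue_ring (int p ^ n)\<^esub>} \<subseteq>
      {p\<in>primes. rat_to_Zp p (f p) n \<noteq> rat_to_Zp p (g p) n}"
    by (auto simp: x_def)
  then have "y \<in> sum_Zmod n" using fin yc by (auto simp: sum_Zmod_iff intro: finite_subset)
  then have "x f \<in> sum_Zmod n +>\<^bsub>prod_Zmod n\<^esub> x g"
    unfolding a_r_coset_def' using yg by force
  then show ?thesis
    unfolding comp by (rule P.a_repr_independence[OF _ c(2) I.a_subgroup, symmetric])
qed

lemma rat_family_hat_extensional: "rat_family_hat f \<in> extensional {1..}"
  by (simp add: rat_family_hat_def A_hat_proj_def)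

lemma rat_family_hat_eqI:
  assumes f: "pintegral_family f" and g: "pintegral_family g"
    and fin: "finite {p\<in>primes. f p \<noteq> g p}"
  shows "rat_family_hat f = rat_family_hat g"
proof (rule extensionalityI[OF rat_family_hat_extensional rat_family_hat_extensional])
  fix n :: nat assume "n \<in> {1..}"
  then show "rat_family_hat f n = rat_family_hat g n"
    by (intro rat_family_hat_component_eqI f g) (auto intro: finite_subset[OF _ fin])
qed

section \<open>Limits of the partial sums\<close>

lemma zeta_star_hat_p_hat_power:
  "zeta_star_hat k \<otimes>\<^bsub>A_hat\<^esub> p_hat [^]\<^bsub>A_hat\<^esub> i =
     rat_family_hat (\<lambda>p. zeta_star (p - 1) k * of_nat p ^ i)"
proof -
  interpret A: cring A_hat by (rule A_hat_cring)
  have pow: "pintegral_family (\<lambda>p. of_nat p ^ i)" for i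
    using pintegral_family_of_nat[of "\<lambda>p. p ^ i"] by simp
  have "p_hat [^]\<^bsub>A_hat\<^esub> i = rat_family_hat (\<lambda>p. of_nat p ^ i)"
  proof (induction i)
    case 0
    then show ?case by (simp add: rat_family_hat_1)
  next
    case (Suc i)
    have "p_hat = rat_family_hat (\<lambda>p. of_nat p ^ 1)" by (simp add: rat_family_hat_def p_hat_def)
    then show ?case
      using rat_family_hat_mult[OF pow[of i] pow[of 1]] Suc by (simp add: mult.commute)
  qed
  then show ?thesis
    using rat_family_hat_mult[OF pintegral_family_zeta_star pow]
    by (simp add: zeta_star_hat_def rat_family_hat_def)
qed

text \<open>The topology comes from a product of discrete spaces, where convergence is checked level
  by level.\<close>

lemma limitin_A_hatI:
  assumes s: "s \<in> carrier A_hat" and S: "\<And>N. S N \<in> carrier A_hat"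
    and ev: "\<And>n. 1 \<le> n \<Longrightarrow> eventually (\<lambda>N. S N n = s n) sequentially"
  shows "limitin A_hat_topology S s sequentially"
proof -
  have mem: "x n \<in> carrier (A_ring n)" if "x \<in> carrier A_hat" "1 \<le> n" for x n
    using that by (simp add: A_hat_def proj_limit_carrier)
  have PiE: "x \<in> (\<Pi>\<^sub>E n\<in>{1..}. carrier (A_ring n))" if "x \<in> carrier A_hat" for x
    using that by (auto simp: A_hat_def proj_limit_carrier PiE_iff)
  have "limitin (discrete_topology (carrier (A_ring n))) (\<lambda>N. S N n) (s n) sequentially"
    if "n \<in> {1..}" for n
    unfolding limitin_def
  proof (intro conjI allI impI)
    show "s n \<in> topspace (discrete_topology (carrier (A_ring n)))" using mem[OF s] that by simp
    fix U assume U: "openin (discrete_topology (carrier (A_ring n))) U \<and> s n \<in> U"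
    have "1 \<le> n" using that by simp
    from ev[OF this] show "eventually (\<lambda>N. S N n \<in> U) sequentially"
      by (rule eventually_mono) (use U in auto)
  qed
  then show ?thesis
    unfolding A_hat_topology_def limitin_subtopology limitin_componentwise
    using s S PiE[OF s] PiE[OF S] by (auto simp: PiE_iff)
qed

text \<open>The two rationals differ by p^(N+1) times a p-integral number, which vanishes modulo
  p^n.\<close>

lemma rat_to_Zp_sum_zeta_star:
  assumes k: "is_index k" and p: "prime p" "odd p" and n: "1 \<le> n" "n \<le> Suc N"
  shows "rat_to_Zp p (\<Sum>i\<le>N. zeta_star (p - 1) (replicate i 1 @ k) * of_nat p ^ i) n =
    rat_to_Zp p (alt_head_sum k (p - 1) (p - 1)) n"
proof -
  define q where "q = p - 1"
  have pq: "p = Suc q" using prime_gt_0_nat[OF p(1)] by (simp add: q_def)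
  have q: "even q" using p(2) pq by simp
  let ?G = "\<Sum>i\<le>N. zeta_star q (replicate i 1 @ k) * of_nat p ^ i"
  let ?R = "\<Sum>j<q. (- 1) ^ j * of_nat (q choose j) * zeta_star (Suc j) (replicate N 1 @ k) *
    (1 / of_nat (Suc j))"
  \<comment> \<open>With both parameters equal to the even number \<open>q\<close>, the prefactor
    (-1)^q C(q, q) is 1.\<close>
  have eq: "alt_head_sum k q q = of_nat p ^ Suc N * ?R + ?G"
    using sum_zeta_star_eq[OF k, of q q N] q by (simp add: pq del: of_nat_Suc power_Suc)
  have R: "is_pintegral p ?R"
    using p pq by (intro is_pintegral_sum is_pintegral_mult[OF p(1)] is_pintegral_alternating_binomial
      is_pintegral_zeta_star is_pintegral_inverse) auto
  have pw: "is_pintegral p (of_nat p ^ i)" for i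
    using p by (intro is_pintegral_power is_pintegral_of_nat)
  have G: "is_pintegral p ?G"
    using p pq by (intro is_pintegral_sum is_pintegral_mult[OF p(1)] is_pintegral_zeta_star pw) auto
  have "rat_to_Zp p (alt_head_sum k q q) n = rat_to_Zp p ?G n"
    unfolding eq rat_to_Zp_add[OF p(1) is_pintegral_mult[OF p(1) pw R] G n(1)]
      rat_to_Zp_power_multiple[OF p(1) R n]
    by (simp add: rat_to_Zp_mod[OF n(1)])
  then show ?thesis by (simp add: q_def)
qed

lemma pintegral_family_alt_head_sum: "pintegral_family (\<lambda>p. alt_head_sum k (p - 1) (p - 1))"
  by (auto simp: pintegral_family_def prime_gt_0_nat intro: is_pintegral_alt_head_sum)

text \<open>At level \<open>n\<close> the partial sums already equal the limit from N = n
  on.\<close>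

theorem zeta_star_hat_sums:
  assumes k: "is_index k"
  shows "A_hat_sums (\<lambda>i. zeta_star_hat (replicate i 1 @ k) \<otimes>\<^bsub>A_hat\<^esub> p_hat [^]\<^bsub>A_hat\<^esub> i)
    (rat_family_hat (\<lambda>p. alt_head_sum k (p - 1) (p - 1)))"
proof -
  define f where "f i p = zeta_star (p - 1) (replicate i 1 @ k) * of_nat p ^ i" for i p
  have f: "pintegral_family (f i)" for i
    unfolding f_def using pintegral_family_of_nat[of "\<lambda>p. p ^ i"]
    by (intro pintegral_family_mult pintegral_family_zeta_star) simp
  have sum: "pintegral_family (\<lambda>p. \<Sum>i<N. f i p)" for N by (intro pintegral_family_sum f)
  have "limitin A_hat_topology (\<lambda>N. rat_family_hat (\<lambda>p. \<Sum>i<N. f i p))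
      (rat_family_hat (\<lambda>p. alt_head_sum k (p - 1) (p - 1))) sequentially"
  proof (intro limitin_A_hatI rat_family_hat_closed pintegral_family_alt_head_sum sum)
    fix n :: nat assume n: "1 \<le> n"
    have "rat_family_hat (\<lambda>p. \<Sum>i<N. f i p) n = rat_family_hat (\<lambda>p. alt_head_sum k (p - 1) (p - 1)) n"
      if N: "n \<le> N" for N
    proof (intro rat_family_hat_component_eqI pintegral_family_alt_head_sum sum n)
      \<comment> \<open>The last exponent is M = N - 1, so the remainder carries p^N, and n <= N
        suffices.\<close>
      obtain M where M: "N = Suc M" using n N by (cases N) auto
      have "rat_to_Zp p (\<Sum>i<N. f i p) n = rat_to_Zp p (alt_head_sum k (p - 1) (p - 1)) n"
        if "prime p" "p \<noteq> 2" for p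
        using rat_to_Zp_sum_zeta_star[OF k that(1) _ n, of M] that N M prime_odd_nat[OF that(1)]
          prime_ge_2_nat[OF that(1)]
        by (simp add: f_def lessThan_Suc_atMost)
      \<comment> \<open>For p = 2 the number p - 1 is odd and the prefactor would be -1; this prime
        goes into the exceptional set.\<close>
      then have "{p\<in>primes. rat_to_Zp p (\<Sum>i<N. f i p) n \<noteq> rat_to_Zp p (alt_head_sum k (p - 1) (p - 1)) n}
          \<subseteq> {2}" by auto
      then show "finite {p\<in>primes. rat_to_Zp p (\<Sum>i<N. f i p) n \<noteq>
          rat_to_Zp p (alt_head_sum k (p - 1) (p - 1)) n}" by (rule finite_subset) simp
    qed
    then show "eventually (\<lambda>N. rat_family_hat (\<lambda>p. \<Sum>i<N. f i p) n =
        rat_family_hat (\<lambda>p. alt_head_sum k (p - 1) (p - 1)) n) sequentially"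
      by (auto simp: eventually_sequentially)
  qed
  then show ?thesis
    unfolding A_hat_sums_def zeta_star_hat_p_hat_power f_def[symmetric]
    by (simp add: rat_family_hat_sum f)
qed

section \<open>Antisymmetry of the limit and conclusion\<close>

lemma rat_family_hat_alt_head_sum_hoffman_dual:
  "rat_family_hat (\<lambda>p. alt_head_sum k (p - 1) (p - 1)) =
     \<ominus>\<^bsub>A_hat\<^esub> rat_family_hat (\<lambda>p. alt_head_sum (hoffman_dual k) (p - 1) (p - 1))"
proof -
  interpret A: cring A_hat by (rule A_hat_cring)
  let ?f = "\<lambda>l p. alt_head_sum l (p - 1) (p - 1)"
  note f = pintegral_family_alt_head_sum
  have 0: "pintegral_family (\<lambda>_. 0)" using pintegral_family_of_nat[of "\<lambda>_. 0"] by simp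
  \<comment> \<open>For odd \<open>p\<close> the identity is exact over the rationals, since p - 1
    is even.\<close>
  have "?f k p + ?f (hoffman_dual k) p = 0" if "prime p" "p \<noteq> 2" for p
    using alt_head_sum_hoffman_dual[of "p - 1" k] prime_odd_nat[OF that(1)] prime_ge_2_nat[OF that(1)] that
    by simp
  then have "{p\<in>primes. ?f k p + ?f (hoffman_dual k) p \<noteq> 0} \<subseteq> {2}" by auto
  then have "rat_family_hat (\<lambda>p. ?f k p + ?f (hoffman_dual k) p) = rat_family_hat (\<lambda>_. 0)"
    by (intro rat_family_hat_eqI pintegral_family_add f 0) (rule finite_subset, auto)
  then have "rat_family_hat (?f k) \<oplus>\<^bsub>A_hat\<^esub> rat_family_hat (?f (hoffman_dual k)) = \<zero>\<^bsub>A_hat\<^esub>"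
    by (simp only: rat_family_hat_add[OF f f] rat_family_hat_0)
  then show ?thesis
    using rat_family_hat_closed[OF f] by (intro A.minus_equality[symmetric])
qed

theorem theorem1p3:
  fixes k :: "nat list"
  assumes "is_index k"
  shows "A_hat_summable
           (\<lambda>i. zeta_star_hat (replicate i 1 @ k) \<otimes>\<^bsub>A_hat\<^esub> p_hat [^]\<^bsub>A_hat\<^esub> i) \<and>
         A_hat_summable
           (\<lambda>i. zeta_star_hat (replicate i 1 @ hoffman_dual k) \<otimes>\<^bsub>A_hat\<^esub> p_hat [^]\<^bsub>A_hat\<^esub> i) \<and>
         A_hat_suminf
           (\<lambda>i. zeta_star_hat (replicate i 1 @ k) \<otimes>\<^bsub>A_hat\<^esub> p_hat [^]\<^bsub>A_hat\<^esub> i) =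
         \<ominus>\<^bsub>A_hat\<^esub> A_hat_suminf
           (\<lambda>i. zeta_star_hat (replicate i 1 @ hoffman_dual k) \<otimes>\<^bsub>A_hat\<^esub> p_hat [^]\<^bsub>A_hat\<^esub> i)"
proof -
  have "is_index (hoffman_dual k)" using hoffman_dual by simp
  \<comment> \<open>The dual is again an index, so both series converge; uniqueness of limits
    reduces the equation to the antisymmetry of the two limits.\<close>
  note sums = zeta_star_hat_sums[OF assms] zeta_star_hat_sums[OF this]
  show ?thesis
    unfolding A_hat_suminf_eqI[OF sums(1)] A_hat_suminf_eqI[OF sums(2)]
    unfolding A_hat_summable_def
    by (intro conjI exI) (rule sums rat_family_hat_alt_head_sum_hoffman_dual)+
qed

end
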